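(* Let $\psi$ be a score function satisfying (i)–(iv) of the context with constants $\beta,\gamma>0$, let $X\sim P$ be a random variable in $\mathcal H$ with a finite second moment and covariance operator $\Sigma$, and suppose $\mathbb{E}[\rho(\|X-\mathbb{E}[X]\|)]<\min\left(\rho(\beta/3),\psi(\beta/2)^2/2\right)$. Then $$V_\psi\le\mathbb{E}[\|X-\mathbb{E}[X]\|^2]=\mathrm{Tr}(\Sigma)\qquad\text{and}\qquad v_\psi\le\|\Sigma\|_{op}+\|\mathbb{E}[X]-T(P)\|^2.$$
   Context: $\mathcal H$ is a real Hilbert space with norm $\|\cdot\|$ coming from its scalar product. Score function: $\psi:\mathbb{R}_+\to\mathbb{R}_+$ satisfies (i) $\psi$ is continuous and differentiable almost everywhere; (ii) $\psi(0)=0$; (iii) $\psi$ is concave; (iv) there are $\beta,\gamma>0$ with $1\ge\psi'(x)\ge\gamma\mathbf{1}\{x\le\beta\}$ for all $x\ge 0$. Put $\rho(x)=\int_0^x\psi(t)\,dt$. $T(P)$ is the (unique) solution of $\mathbb{E}\left[\frac{X-T(P)}{\|X-T(P)\|}\psi(\|X-T(P)\|)\right]=0$, equivalently the minimizer of $\theta\mapsto\mathbb{E}[\rho(\|X-\theta\|)]$ (integrands are $0$ where the denominator vanishes). $V_\psi=\mathbb{E}[\psi(\|X-T(P)\|)^2]$ and $v_\psi=\left\|\mathbb{E}\left[\frac{(X-T(P))(X-T(P))^T}{\|X-T(P)\|^2}\psi(\|X-T(P)\|)^2\right]\right\|_{op}$. *)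

theory Defs
  imports "HOL-Analysis.Analysis" "HOL-Probability.Probability_Measure"
begin

section \<open>Expectation of Hilbert-space valued and operator-valued random variables\<close>

text \<open>
  The Bochner integral of the library is restricted to second countable value spaces. That
  excludes non-separable Hilbert spaces, and also the space of bounded operators (with the
  operator norm) on a separable infinite-dimensional one. The next two definitions are those of
  \<open>has_bochner_integral\<close> and \<open>lebesgue_integral\<close> without this restriction; for second countable
  spaces they agree with the library, see \<open>has_bexp_iff_library\<close> and \<open>bexp_eq_library\<close>.
\<close>

inductive has_bexp :: "'w measure \<Rightarrow> ('w \<Rightarrow> 'b) \<Rightarrow> 'b::real_normed_vector \<Rightarrow> bool"
  for M f x where
  "f \<in> borel_measurable M \<Longrightarrow>
    (\<And>i. Bochner_Integration.simple_bochner_integrable M (s i)) \<Longrightarrow>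
    (\<lambda>i. \<integral>\<^sup>+w. norm (f w - s i w) \<partial>M) \<longlonglongrightarrow> 0 \<Longrightarrow>
    (\<lambda>i. Bochner_Integration.simple_bochner_integral M (s i)) \<longlonglongrightarrow> x \<Longrightarrow>
    has_bexp M f x"

definition bexp :: "'w measure \<Rightarrow> ('w \<Rightarrow> 'b) \<Rightarrow> 'b::real_normed_vector" where
  "bexp M f = (if \<exists>x. has_bexp M f x then THE x. has_bexp M f x else 0)"

lemma has_bexp_iff_library:
  fixes f :: "'w \<Rightarrow> 'b::{real_normed_vector, second_countable_topology}"
  shows "has_bexp M f x \<longleftrightarrow> has_bochner_integral M f x"
  unfolding has_bexp.simps has_bochner_integral.simps by blast

lemma bexp_eq_library:
  fixes f :: "'w \<Rightarrow> 'b::{banach, second_countable_topology}"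
  shows "bexp M f = integral\<^sup>L M f"
  unfolding bexp_def lebesgue_integral_def has_bexp_iff_library by simp

text \<open>
  Random variables in a possibly non-separable space are understood in the strong (Bochner)
  sense. In a second countable space this is just Borel measurability.
\<close>

definition strongly_measurable :: "'w measure \<Rightarrow> ('w \<Rightarrow> 'b::real_normed_vector) \<Rightarrow> bool" where
  "strongly_measurable M X \<longleftrightarrow> X \<in> borel_measurable M \<and>
    (\<exists>s. (\<forall>i. simple_function M (s i)) \<and> (AE w in M. (\<lambda>i::nat. s i w) \<longlonglongrightarrow> X w))"

lemma strongly_measurable_iff_borel:
  fixes X :: "'w \<Rightarrow> 'b::{real_normed_vector, second_countable_topology}"
  shows "strongly_measurable M X \<longleftrightarrow> X \<in> borel_measurable M"
proof
  assume X: "X \<in> borel_measurable M"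
  obtain s where "\<forall>i. simple_function M (s i)" "\<forall>w\<in>space M. (\<lambda>i. s i w) \<longlonglongrightarrow> X w"
    using borel_measurable_implies_sequence_metric[OF X, of 0] by blast
  then show "strongly_measurable M X"
    unfolding strongly_measurable_def using X by (auto intro!: exI[of _ s] AE_I2)
qed (simp add: strongly_measurable_def)


section \<open>Operators\<close>

text \<open>The rank-one operator \<open>x y\<^sup>T\<close>, that is \<open>u \<mapsto> (y \<bullet> u) x\<close>.\<close>

definition outer :: "'a::real_inner \<Rightarrow> 'a \<Rightarrow> 'a \<Rightarrow>\<^sub>L 'a" where
  "outer x y = blinfun_scaleR_left x o\<^sub>L blinfun_inner_right y"

lemma outer_apply [simp]: "blinfun_apply (outer x y) u = (y \<bullet> u) *\<^sub>R x"
  by (simp add: outer_def)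

definition orthonormal_basis :: "'a::real_inner set \<Rightarrow> bool" where
  "orthonormal_basis B \<longleftrightarrow>
    pairwise orthogonal B \<and> (\<forall>e\<in>B. norm e = 1) \<and> closure (span B) = UNIV"

text \<open>
  For positive operators, such as covariance operators, the sum does not depend on the basis.
\<close>

definition op_trace :: "('a::real_inner \<Rightarrow>\<^sub>L 'a) \<Rightarrow> real" where
  "op_trace A = (\<Sum>\<^sub>\<infinity>e\<in>(SOME B. orthonormal_basis B). blinfun_apply A e \<bullet> e)"

definition covariance_operator :: "'w measure \<Rightarrow> ('w \<Rightarrow> 'a::real_inner) \<Rightarrow> 'a \<Rightarrow>\<^sub>L 'a" where
  "covariance_operator M X = bexp M (\<lambda>w. outer (X w - bexp M X) (X w - bexp M X))"


section \<open>Score functions and the associated M-estimator\<close>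

text \<open>
  Functions on the nonnegative reals are represented by functions on \<open>real\<close> whose values at
  negative arguments are irrelevant. The bounds on the derivative are imposed wherever it exists;
  at \<open>0\<close> it is the right derivative.
\<close>

definition score_function :: "real \<Rightarrow> real \<Rightarrow> (real \<Rightarrow> real) \<Rightarrow> bool" where
  "score_function \<beta> \<gamma> \<psi> \<longleftrightarrow>
    \<beta> > 0 \<and> \<gamma> > 0 \<and>
    (\<forall>x\<ge>0. \<psi> x \<ge> 0) \<and>
    continuous_on {0..} \<psi> \<and>
    (AE x in lborel. x \<ge> 0 \<longrightarrow> \<psi> differentiable (at x within {0..})) \<and>
    \<psi> 0 = 0 \<and>
    concave_on {0..} \<psi> \<and>
    (\<forall>x\<ge>0. \<forall>D. (\<psi> has_real_derivative D) (at x within {0..}) \<longrightarrow>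
       D \<le> 1 \<and> \<gamma> * indicator {..\<beta>} x \<le> D)"

definition rho :: "(real \<Rightarrow> real) \<Rightarrow> real \<Rightarrow> real" where
  "rho \<psi> x = integral {0..x} \<psi>"

text \<open>
  The value \<open>T(P)\<close> for \<open>P\<close> the law of \<open>X\<close>. Since \<open>0 / 0 = 0\<close>, the integrands below vanish
  where \<open>X w\<close> equals the centre.
\<close>

definition location :: "(real \<Rightarrow> real) \<Rightarrow> 'w measure \<Rightarrow> ('w \<Rightarrow> 'a::real_inner) \<Rightarrow> 'a" where
  "location \<psi> M X =
    (THE \<theta>. has_bexp M (\<lambda>w. (\<psi> (norm (X w - \<theta>)) / norm (X w - \<theta>)) *\<^sub>R (X w - \<theta>)) 0)"

definition V_psi :: "(real \<Rightarrow> real) \<Rightarrow> 'w measure \<Rightarrow> ('w \<Rightarrow> 'a::real_inner) \<Rightarrow> real" where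
  "V_psi \<psi> M X = (\<integral>w. (\<psi> (norm (X w - location \<psi> M X)))\<^sup>2 \<partial>M)"

definition v_psi :: "(real \<Rightarrow> real) \<Rightarrow> 'w measure \<Rightarrow> ('w \<Rightarrow> 'a::real_inner) \<Rightarrow> real" where
  "v_psi \<psi> M X =
    (let T = location \<psi> M X in
      norm (bexp M (\<lambda>w. ((\<psi> (norm (X w - T)))\<^sup>2 / (norm (X w - T))\<^sup>2) *\<^sub>R
                        outer (X w - T) (X w - T))))"

end

theory Submission
  imports Defs
begin

text \<open>
  Since \<open>\<psi>\<close> is \<open>1\<close>-Lipschitz with \<open>\<psi> 0 = 0\<close>, one has \<open>\<psi>\<^sup>2 \<le> 2 \<rho>\<close> and \<open>2 \<rho> x \<le> x\<^sup>2\<close>, and \<open>T\<close> minimizes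
  \<open>\<theta> \<mapsto> E[\<rho> \<parallel>X - \<theta>\<parallel>]\<close>; comparing \<open>T\<close> with the mean bounds \<open>V\<^sub>\<psi>\<close>. Since \<open>\<psi> x \<le> x\<close>, the operator in
  \<open>v\<^sub>\<psi>\<close> is dominated by the second moment of \<open>X - T\<close>, that is, by the covariance plus the rank-one
  operator of \<open>E X - T\<close>. The smallness assumption enters only through the uniqueness of \<open>T\<close>.
  Its existence holds because the objective is convex, coercive and has the explicit two-sided
  quadratic bounds \<open>0 \<le> f (\<theta> + h) - f \<theta> + \<langle>g, h\<rangle> \<le> \<parallel>h\<parallel>\<^sup>2 / 2\<close> with \<open>g\<close> the mean score at \<open>\<theta>\<close>.
\<close>

section \<open>Bochner expectation without separability\<close>

text \<open>Without separability the difference of two Borel functions may fail to be Borel. A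
  simple function takes finitely many values \<open>v\<close>, and for each fixed \<open>v\<close>
  the map \<open>x \<mapsto> norm (x - v)\<close> is continuous.\<close>

lemma borel_measurable_norm_diff_simple:
  fixes f :: "'w \<Rightarrow> 'b::real_normed_vector"
  assumes f: "f \<in> borel_measurable M" and s: "simple_function M s"
  shows "(\<lambda>w. norm (f w - s w)) \<in> borel_measurable M"
proof (rule measurable_compose_countable'[where f = "\<lambda>v w. norm (f w - v)" and g = s and I = "s ` space M"])
  fix v :: 'b
  have "(\<lambda>x. norm (x - v)) \<in> borel_measurable borel"
    by (intro borel_measurable_continuous_onI continuous_intros)
  then show "(\<lambda>w. norm (f w - v)) \<in> borel_measurable M"
    using f by (rule measurable_compose[rotated])
next
  show "s \<in> measurable M (count_space (s ` space M))"
    using s measurable_simple_function by (fastforce simp: measurable_def)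
  show "countable (s ` space M)"
    using s by (auto simp: simple_function_def countable_finite)
qed

text \<open>Triangle inequality through \<open>f\<close>. It serves twice: for uniqueness of the
  expectation and for the Cauchy property behind its existence.\<close>

lemma simple_bochner_integral_dist_le:
  fixes f :: "'w \<Rightarrow> 'b::real_normed_vector"
  assumes f: "f \<in> borel_measurable M"
    and s: "Bochner_Integration.simple_bochner_integrable M s"
    and t: "Bochner_Integration.simple_bochner_integrable M t"
  shows "ennreal (norm (Bochner_Integration.simple_bochner_integral M s
      - Bochner_Integration.simple_bochner_integral M t)) \<le>
    (\<integral>\<^sup>+w. norm (f w - s w) \<partial>M) + (\<integral>\<^sup>+w. norm (f w - t w) \<partial>M)"
    (is "ennreal (norm (?s - ?t)) \<le> _")
proof -
  have sf: "simple_function M s" "simple_function M t"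
    using s t by (auto elim: Bochner_Integration.simple_bochner_integrable.cases)
  have [measurable]: "(\<lambda>w. norm (f w - s w)) \<in> borel_measurable M"
    "(\<lambda>w. norm (f w - t w)) \<in> borel_measurable M"
    using borel_measurable_norm_diff_simple f sf by blast+
  have "ennreal (norm (?s - ?t)) =
      norm (Bochner_Integration.simple_bochner_integral M (\<lambda>w. s w - t w))"
    using s t by (simp add: Bochner_Integration.simple_bochner_integral_diff)
  also have "\<dots> \<le> Bochner_Integration.simple_bochner_integral M (\<lambda>w. norm (s w - t w))"
    using Bochner_Integration.simple_bochner_integrable_compose2[of "(-)" M s t] s t
    by (auto intro!: Bochner_Integration.simple_bochner_integral_norm_bound)
  also have "\<dots> = (\<integral>\<^sup>+w. norm (s w - t w) \<partial>M)"
    using Bochner_Integration.simple_bochner_integrable_compose2[of "\<lambda>x y. norm (x - y)" M s t] s t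
    by (auto intro!: Bochner_Integration.simple_bochner_integral_eq_nn_integral)
  also have "\<dots> \<le> (\<integral>\<^sup>+w. ennreal (norm (f w - s w)) + ennreal (norm (f w - t w)) \<partial>M)"
  proof (rule nn_integral_mono)
    fix w
    have "norm (s w - t w) \<le> norm (f w - s w) + norm (f w - t w)"
      by (metis dual_order.refl norm_diff_triangle_le norm_minus_commute)
    then show "ennreal (norm (s w - t w)) \<le> ennreal (norm (f w - s w)) + ennreal (norm (f w - t w))"
      by (metis ennreal_leI ennreal_plus norm_ge_zero)
  qed
  also have "\<dots> = (\<integral>\<^sup>+w. norm (f w - s w) \<partial>M) + (\<integral>\<^sup>+w. norm (f w - t w) \<partial>M)"
    by (rule nn_integral_add) auto
  finally show ?thesis .
qed

lemma has_bexp_unique: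
  assumes "has_bexp M f x" "has_bexp M f y"
  shows "x = y"
proof -
  obtain s where f: "f \<in> borel_measurable M"
    and s: "\<And>i. Bochner_Integration.simple_bochner_integrable M (s i)"
    and s0: "(\<lambda>i::nat. \<integral>\<^sup>+w. norm (f w - s i w) \<partial>M) \<longlonglongrightarrow> 0"
    and sx: "(\<lambda>i. Bochner_Integration.simple_bochner_integral M (s i)) \<longlonglongrightarrow> x"
    using assms(1) by (cases rule: has_bexp.cases) blast
  obtain t where t: "\<And>i. Bochner_Integration.simple_bochner_integrable M (t i)"
    and t0: "(\<lambda>i::nat. \<integral>\<^sup>+w. norm (f w - t i w) \<partial>M) \<longlonglongrightarrow> 0"
    and ty: "(\<lambda>i. Bochner_Integration.simple_bochner_integral M (t i)) \<longlonglongrightarrow> y"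
    using assms(2) by (cases rule: has_bexp.cases) blast
  have "(\<lambda>i. ennreal (norm (Bochner_Integration.simple_bochner_integral M (s i)
      - Bochner_Integration.simple_bochner_integral M (t i)))) \<longlonglongrightarrow> ennreal (norm (x - y))"
    by (intro tendsto_ennrealI tendsto_intros sx ty)
  moreover have "(\<lambda>i. ennreal (norm (Bochner_Integration.simple_bochner_integral M (s i)
      - Bochner_Integration.simple_bochner_integral M (t i)))) \<longlonglongrightarrow> 0"
  proof (rule tendsto_sandwich[OF _ _ tendsto_const])
    show "(\<lambda>i. (\<integral>\<^sup>+w. norm (f w - s i w) \<partial>M) + (\<integral>\<^sup>+w. norm (f w - t i w) \<partial>M)) \<longlonglongrightarrow> 0"
      using tendsto_add[OF s0 t0] by simp
  qed (use simple_bochner_integral_dist_le[OF f s t] in auto)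
  ultimately have "ennreal (norm (x - y)) = 0"
    by (rule LIMSEQ_unique)
  then show ?thesis by (simp add: ennreal_eq_0_iff)
qed

lemma bexp_eqI: "has_bexp M f x \<Longrightarrow> bexp M f = x"
  unfolding bexp_def using has_bexp_unique by (auto intro!: the_equality)

text \<open>The bridge to ordinary integrals: a real-valued bounded linear \<open>T\<close>, such as
  pairing with a vector, turns a vector or operator expectation into a Lebesgue integral. The
  approximation error grows at most by the bound \<open>K\<close> of \<open>T\<close>.\<close>

lemma has_bexp_bounded_linear:
  fixes f :: "'w \<Rightarrow> 'b::real_normed_vector" and T :: "'b \<Rightarrow> 'c::real_normed_vector"
  assumes "bounded_linear T" and "has_bexp M f x"
  shows "has_bexp M (\<lambda>w. T (f w)) (T x)"
proof -
  interpret T: bounded_linear T by fact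
  obtain K where K: "0 < K" "\<And>x. norm (T x) \<le> norm x * K"
    using T.pos_bounded by blast
  obtain s where f: "f \<in> borel_measurable M"
    and s: "\<And>i. Bochner_Integration.simple_bochner_integrable M (s i)"
    and s0: "(\<lambda>i::nat. \<integral>\<^sup>+w. norm (f w - s i w) \<partial>M) \<longlonglongrightarrow> 0"
    and sx: "(\<lambda>i. Bochner_Integration.simple_bochner_integral M (s i)) \<longlonglongrightarrow> x"
    using assms(2) by (cases rule: has_bexp.cases) blast
  have sf: "simple_function M (s i)" for i
    using s by (auto elim: Bochner_Integration.simple_bochner_integrable.cases)
  have [measurable]: "(\<lambda>w. norm (f w - s i w)) \<in> borel_measurable M" for i
    using borel_measurable_norm_diff_simple f sf by blast
  show ?thesis
  proof (rule has_bexp.intros[where s = "\<lambda>i w. T (s i w)"])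
    have "T \<in> borel_measurable borel"
      by (intro borel_measurable_continuous_onI T.continuous_on continuous_on_id)
    then show "(\<lambda>w. T (f w)) \<in> borel_measurable M"
      using f by (rule measurable_compose[rotated])
    show "Bochner_Integration.simple_bochner_integrable M (\<lambda>w. T (s i w))" for i
      using Bochner_Integration.simple_bochner_integrable_compose2[of "\<lambda>x _. T x", OF T.zero s s] .
    show "(\<lambda>i. Bochner_Integration.simple_bochner_integral M (\<lambda>w. T (s i w))) \<longlonglongrightarrow> T x"
      using T.tendsto[OF sx]
      by (simp add: Bochner_Integration.simple_bochner_integral_linear[OF T.linear_axioms s])
    show "(\<lambda>i. \<integral>\<^sup>+w. norm (T (f w) - T (s i w)) \<partial>M) \<longlonglongrightarrow> 0"
    proof (rule tendsto_sandwich[OF _ _ tendsto_const])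
      show "(\<lambda>i. ennreal K * (\<integral>\<^sup>+w. norm (f w - s i w) \<partial>M)) \<longlonglongrightarrow> 0"
        using ennreal_tendsto_cmult[OF _ s0, of "ennreal K"] by simp
      have "(\<integral>\<^sup>+w. norm (T (f w) - T (s i w)) \<partial>M) \<le> (\<integral>\<^sup>+w. ennreal K * norm (f w - s i w) \<partial>M)" for i
        using K by (intro nn_integral_mono)
          (auto simp flip: T.diff ennreal_mult intro!: ennreal_leI simp: mult.commute)
      then show "\<forall>\<^sub>F i in sequentially. (\<integral>\<^sup>+w. norm (T (f w) - T (s i w)) \<partial>M)
          \<le> ennreal K * (\<integral>\<^sup>+w. norm (f w - s i w) \<partial>M)"
        by (intro always_eventually allI) (subst nn_integral_cmult[symmetric]; simp)
    qed auto
  qed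
qed

text \<open>Truncated simple approximants converge to \<open>f\<close> in mean by dominated
  convergence, so their integrals form a Cauchy sequence, and the value space is complete.\<close>

lemma has_bexp_exists:
  fixes f :: "'w \<Rightarrow> 'b::banach"
  assumes f: "strongly_measurable M f" and int: "integrable M (\<lambda>w. norm (f w))"
  shows "\<exists>x. has_bexp M f x"
proof -
  obtain s where fm: "f \<in> borel_measurable M" and s: "\<And>i. simple_function M (s i)"
    and lim: "AE w in M. (\<lambda>i::nat. s i w) \<longlonglongrightarrow> f w"
    using f unfolding strongly_measurable_def by blast
  \<comment> \<open>An approximant is replaced by 0 wherever 0 is at least as good; the error is
    then dominated by the integrable function \<open>norm (f w)\<close>.\<close>
  define t where "t i w = (if norm (f w - s i w) \<le> norm (f w) then s i w else 0)" for i w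
  have fin: "(\<integral>\<^sup>+w. norm (f w) \<partial>M) < \<infinity>"
    using int by (auto simp: integrable_iff_bounded)
  note meas [measurable] = borel_measurable_norm_diff_simple[OF fm s] and [measurable] = fm
  have nf [measurable]: "(\<lambda>w. norm (f w)) \<in> borel_measurable M"
    using int by auto
  have tb: "norm (f w - t i w) \<le> norm (f w)" for i w
    by (simp add: t_def)
  have ts: "simple_function M (t i)" for i
    unfolding t_def by (intro simple_function_If s simple_function_const) measurable
  note tm [measurable] = borel_measurable_norm_diff_simple[OF fm ts]
  have tint: "Bochner_Integration.simple_bochner_integrable M (t i)" for i
  proof (rule Bochner_Integration.simple_bochner_integrableI_bounded[OF ts])
    have "(\<integral>\<^sup>+w. norm (t i w) \<partial>M) \<le> (\<integral>\<^sup>+w. 2 * ennreal (norm (f w)) \<partial>M)"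
    proof (rule nn_integral_mono)
      fix w
      have "norm (t i w) \<le> 2 * norm (f w)"
        using tb[of w i] norm_triangle_sub[of "t i w" "f w"] by (simp add: norm_minus_commute)
      then show "ennreal (norm (t i w)) \<le> 2 * ennreal (norm (f w))"
        by (metis ennreal_leI ennreal_mult'' ennreal_numeral norm_ge_zero)
    qed
    also have "\<dots> < \<infinity>"
      using fin by (subst nn_integral_cmult) (auto simp: ennreal_mult_less_top)
    finally show "(\<integral>\<^sup>+w. norm (t i w) \<partial>M) < \<infinity>" .
  qed
  have t0: "(\<lambda>i. \<integral>\<^sup>+w. norm (f w - t i w) \<partial>M) \<longlonglongrightarrow> 0"
  proof -
    have "(\<lambda>i. \<integral>\<^sup>+w. norm (f w - t i w) \<partial>M) \<longlonglongrightarrow> (\<integral>\<^sup>+w. 0 \<partial>M)"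
    proof (rule nn_integral_dominated_convergence[where w = "\<lambda>w. norm (f w)"])
      show "AE w in M. (\<lambda>i. ennreal (norm (f w - t i w))) \<longlonglongrightarrow> 0"
        using lim
      proof eventually_elim
        fix w assume w: "(\<lambda>i. s i w) \<longlonglongrightarrow> f w"
        have n0: "(\<lambda>i. norm (f w - s i w)) \<longlonglongrightarrow> 0"
          using tendsto_norm[OF tendsto_diff[OF tendsto_const[of "f w"] w]] by simp
        \<comment> \<open>Where \<open>f w \<noteq> 0\<close> the truncation is eventually inactive;
          where \<open>f w = 0\<close> the bound \<open>tb\<close> already makes the error
          0.\<close>
        have "(\<lambda>i. norm (f w - t i w)) \<longlonglongrightarrow> 0"
        proof (cases "f w = 0")
          case True
          then show ?thesis using tb[of w] by simp
        next
          case False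
          have "\<forall>\<^sub>F i in sequentially. norm (f w - s i w) < norm (f w)"
            using n0 False by (intro order_tendstoD(2)) auto
          then have "\<forall>\<^sub>F i in sequentially. norm (f w - s i w) = norm (f w - t i w)"
            by eventually_elim (simp add: t_def)
          with n0 show ?thesis by (rule Lim_transform_eventually)
        qed
        then show "(\<lambda>i. ennreal (norm (f w - t i w))) \<longlonglongrightarrow> 0"
          using tendsto_ennrealI by force
      qed
    qed (use fin tb in \<open>auto intro!: ennreal_leI\<close>)
    then show ?thesis by simp
  qed
  have "Cauchy (\<lambda>i. Bochner_Integration.simple_bochner_integral M (t i))"
  proof (rule metric_CauchyI)
    fix e :: real assume e: "0 < e"
    then have "\<forall>\<^sub>F i in sequentially. (\<integral>\<^sup>+w. norm (f w - t i w) \<partial>M) < ennreal (e / 2)"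
      using t0 by (intro order_tendstoD(2)) auto
    then obtain N where N: "\<And>i. i \<ge> N \<Longrightarrow> (\<integral>\<^sup>+w. norm (f w - t i w) \<partial>M) < ennreal (e / 2)"
      by (auto simp: eventually_sequentially)
    show "\<exists>N. \<forall>m\<ge>N. \<forall>n\<ge>N. dist (Bochner_Integration.simple_bochner_integral M (t m))
        (Bochner_Integration.simple_bochner_integral M (t n)) < e"
    proof (intro exI allI impI)
      fix m n assume mn: "m \<ge> N" "n \<ge> N"
      have "ennreal (norm (Bochner_Integration.simple_bochner_integral M (t m)
          - Bochner_Integration.simple_bochner_integral M (t n))) < ennreal (e / 2) + ennreal (e / 2)"
        using simple_bochner_integral_dist_le[OF fm tint tint, of m n] N[OF mn(1)] N[OF mn(2)]
        by (meson add_strict_mono order_le_less_trans)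
      also have "\<dots> = ennreal e"
        using e by (simp flip: ennreal_plus)
      finally show "dist (Bochner_Integration.simple_bochner_integral M (t m))
        (Bochner_Integration.simple_bochner_integral M (t n)) < e"
        using e by (simp add: dist_norm ennreal_less_iff)
    qed
  qed
  then obtain x where "(\<lambda>i. Bochner_Integration.simple_bochner_integral M (t i)) \<longlonglongrightarrow> x"
    using Cauchy_convergent convergent_def by blast
  then show ?thesis
    using has_bexp.intros[OF fm tint t0] by blast
qed

lemma strongly_measurable_compose:
  assumes "strongly_measurable M f" and g: "continuous_on UNIV g"
  shows "strongly_measurable M (\<lambda>w. g (f w))"
proof -
  obtain s where fm: "f \<in> borel_measurable M" and s: "\<And>i. simple_function M (s i)"
    and lim: "AE w in M. (\<lambda>i::nat. s i w) \<longlonglongrightarrow> f w"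
    using assms(1) unfolding strongly_measurable_def by blast
  have "(\<lambda>w. g (f w)) \<in> borel_measurable M"
    using borel_measurable_continuous_onI[OF g] fm by (rule measurable_compose[rotated])
  moreover have "AE w in M. (\<lambda>i. g (s i w)) \<longlonglongrightarrow> g (f w)"
    using lim by eventually_elim (rule continuous_on_tendsto_compose[OF g], auto)
  ultimately show ?thesis
    unfolding strongly_measurable_def
    using simple_function_compose1[OF s] by (intro conjI exI[of _ "\<lambda>i w. g (s i w)"]) auto
qed

section \<open>Score functions\<close>

text \<open>Mean value theorem, with one-sided derivatives at the end points so that it applies to
  \<open>rho\<close> on intervals starting at 0. All comparisons of \<open>rho\<close> with affine
  and quadratic functions come from it.\<close>

lemma deriv_nonneg_imp_le:
  fixes g :: "real \<Rightarrow> real"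
  assumes "a \<le> b"
    and "\<And>x. a \<le> x \<Longrightarrow> x \<le> b \<Longrightarrow> (g has_real_derivative g' x) (at x within {a..b})"
    and "\<And>x. a \<le> x \<Longrightarrow> x \<le> b \<Longrightarrow> 0 \<le> g' x"
  shows "g a \<le> g b"
proof (cases "a = b")
  case False
  with assms(1) have "a < b" by simp
  then obtain x where "x \<in> {a<..<b}" "g b - g a = g' x * (b - a)"
    using mvt_simple[of a b g "\<lambda>x. (*) (g' x)"] assms(2) by (auto simp: has_field_derivative_def)
  moreover have "0 \<le> g' x * (b - a)"
    using assms(3)[of x] \<open>x \<in> {a<..<b}\<close> \<open>a < b\<close> by auto
  ultimately show ?thesis by simp
qed simp

section \<open>Consequences of concavity and of the derivative bounds\<close>

context
  fixes \<psi> :: "real \<Rightarrow> real" and \<beta> \<gamma> :: real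
  assumes score: "score_function \<beta> \<gamma> \<psi>"
begin

lemma beta_pos: "0 < \<beta>" and psi_zero: "\<psi> 0 = 0"
  and psi_nonneg: "0 \<le> x \<Longrightarrow> 0 \<le> \<psi> x"
  and psi_continuous: "continuous_on {0..} \<psi>"
  using score by (auto simp: score_function_def)

lemma derivative_bounds:
  assumes "0 \<le> x" and "(\<psi> has_real_derivative D) (at x within {0..})"
  shows "D \<le> 1" and "x \<le> \<beta> \<Longrightarrow> \<gamma> \<le> D"
proof -
  have "D \<le> 1 \<and> \<gamma> * indicator {..\<beta>} x \<le> D"
    using score assms unfolding score_function_def by blast
  then show "D \<le> 1" "x \<le> \<beta> \<Longrightarrow> \<gamma> \<le> D" by auto
qed

text \<open>Concavity with the denominator \<open>z - x\<close> cleared, so that coinciding points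
  are allowed.\<close>

lemma psi_chord:
  assumes "0 \<le> x" "x \<le> y" "y \<le> z"
  shows "(z - y) * \<psi> x + (y - x) * \<psi> z \<le> (z - x) * \<psi> y"
proof (cases "x = z")
  case False
  with assms have xz: "x < z" by simp
  define t where "t = (y - x) / (z - x)"
  have t: "0 \<le> t" "t \<le> 1"
    using assms xz by (auto simp: t_def field_simps)
  have tz: "t * (z - x) = y - x"
    using xz by (simp add: t_def)
  then have tz': "(1 - t) * (z - x) = z - y"
    by (simp add: algebra_simps)
  have eq: "(1 - t) * x + t * z = y"
    using tz by (simp add: algebra_simps)
  have "concave_on {0..} \<psi>"
    using score by (simp add: score_function_def)
  then have "(1 - t) * \<psi> x + t * \<psi> z \<le> \<psi> y"
    using concave_onD[of "{0..}" \<psi> t x z] t assms eq by simp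
  then have "((1 - t) * \<psi> x + t * \<psi> z) * (z - x) \<le> \<psi> y * (z - x)"
    using xz by (intro mult_right_mono) auto
  moreover have "((1 - t) * \<psi> x + t * \<psi> z) * (z - x) =
      ((1 - t) * (z - x)) * \<psi> x + (t * (z - x)) * \<psi> z"
    by (simp add: algebra_simps)
  ultimately show ?thesis by (simp only: tz tz') (simp add: mult.commute)
qed (use assms in simp)

lemma psi_mono:
  assumes "0 \<le> x" "x \<le> y"
  shows "\<psi> x \<le> \<psi> y"
proof (rule ccontr)
  assume "\<not> \<psi> x \<le> \<psi> y"
  then have d: "0 < \<psi> x - \<psi> y" by simp
  \<comment> \<open>The line through the graph points at \<open>x\<close> and \<open>y\<close> hits
    zero at \<open>y + (y - x) * \<psi> y / (\<psi> x - \<psi> y)\<close>. One unit further it is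
    negative, and concavity puts \<open>\<psi> z\<close> below it.\<close>
  define z where "z = y + ((y - x) * \<psi> y / (\<psi> x - \<psi> y) + 1)"
  have "0 \<le> (y - x) * \<psi> y / (\<psi> x - \<psi> y)"
    using assms d psi_nonneg[of y] by simp
  then have "y \<le> z" by (simp add: z_def)
  have "(z - y) * (\<psi> x - \<psi> y) = (y - x) * \<psi> y + (\<psi> x - \<psi> y)"
    using d by (simp add: z_def field_simps)
  moreover have "(z - y) * \<psi> x \<le> (z - x) * \<psi> y"
  proof -
    have "0 \<le> (y - x) * \<psi> z"
      using psi_nonneg[of z] assms \<open>y \<le> z\<close> by simp
    then show ?thesis using psi_chord[OF assms \<open>y \<le> z\<close>] by linarith
  qed
  ultimately show False using d by (simp add: algebra_simps)
qed

text \<open>Chord from the origin, where \<open>\<psi>\<close> vanishes: this is the monotonicity of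
  \<open>\<psi> x / x\<close>, without division.\<close>

lemma psi_star:
  assumes "0 \<le> t" "t \<le> r"
  shows "t * \<psi> r \<le> r * \<psi> t"
  using psi_chord[of 0 t r] assms psi_zero by simp

text \<open>A nonempty open interval has positive Lebesgue measure and so meets the set of
  differentiability. This is how the derivative bounds, known only at such points, become
  usable.\<close>

lemma psi_differentiable_between:
  assumes "0 \<le> a" "a < b"
  obtains y D where "a < y" "y < b" "(\<psi> has_real_derivative D) (at y within {0..})"
proof -
  have "\<exists>y\<in>{a<..<b}. \<psi> differentiable (at y within {0..})"
  proof (rule ccontr)
    assume neg: "\<not> ?thesis"
    have "AE x in lborel. x \<ge> 0 \<longrightarrow> \<psi> differentiable (at x within {0..})"
      using score by (simp add: score_function_def)
    then have "AE x in lborel. x \<notin> {a<..<b}"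
      by eventually_elim (use neg assms in force)
    then have "{a<..<b} \<in> null_sets lborel"
      by (subst AE_iff_null_sets) auto
    then have "emeasure lborel {a<..<b} = 0" by (rule null_setsD1)
    then show False using assms by simp
  qed
  then show ?thesis
    using that by (auto simp: real_differentiable_def)
qed

lemma psi_below_tangent:
  assumes "0 < y" "(\<psi> has_real_derivative D) (at y within {0..})" "0 \<le> x"
  shows "\<psi> x \<le> \<psi> y + D * (x - y)"
proof -
  have "convex_on {0..} (\<lambda>x. - \<psi> x)"
    using score by (simp add: score_function_def concave_on_def)
  moreover have "((\<lambda>x. - \<psi> x) has_real_derivative - D) (at y within {0..})"
    by (intro DERIV_minus assms)
  moreover have "y \<in> interior {0..}"
    using assms by simp
  ultimately have "- \<psi> x - - \<psi> y \<ge> - D * (x - y)"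
    using assms(3) by (intro convex_on_imp_above_tangent[of "{0..}"]) auto
  then show ?thesis by simp
qed

text \<open>Differentiability at 0 is not given, so 0 is approached by points \<open>y\<close> of
  differentiability: the tangent at \<open>y\<close> has slope at most 1 and lies above
  \<open>\<psi>\<close>, while \<open>\<psi> y\<close> is small by continuity.\<close>

lemma psi_le_id:
  assumes "0 \<le> x"
  shows "\<psi> x \<le> x"
proof (cases "x = 0")
  case False
  then have x: "0 < x" using assms by simp
  show ?thesis
  proof (rule field_le_epsilon)
    fix e :: real assume "0 < e"
    then have "\<exists>d>0. \<forall>y\<in>{0..}. dist y 0 < d \<longrightarrow> dist (\<psi> y) (\<psi> 0) < e"
      using psi_continuous unfolding continuous_on_iff by (meson atLeast_iff order_refl)
    then obtain d where d: "0 < d" "\<And>y. 0 \<le> y \<Longrightarrow> y < d \<Longrightarrow> \<psi> y < e"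
      by (force simp: dist_real_def psi_zero)
    obtain y D where y: "0 < y" "y < min d x" "(\<psi> has_real_derivative D) (at y within {0..})"
      using psi_differentiable_between[of 0 "min d x"] d x by auto
    have "D \<le> 1"
      by (rule derivative_bounds(1)[OF _ y(3)]) (use y in simp)
    then have D: "D * (x - y) \<le> 1 * (x - y)"
      using y by (intro mult_right_mono) auto
    have "\<psi> x \<le> \<psi> y + D * (x - y)"
      by (rule psi_below_tangent[OF y(1,3) assms])
    also have "\<dots> \<le> e + 1 * (x - y)"
      using D d(2)[of y] y by (intro add_mono) auto
    finally show "\<psi> x \<le> x + e"
      using y(1) by simp
  qed
qed (simp add: psi_zero)

text \<open>By \<open>psi_star\<close> the chord slope between \<open>t\<close> and \<open>r\<close>
  is at most \<open>\<psi> r / r\<close>, hence at most 1.\<close>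

lemma psi_diff_le:
  assumes "0 \<le> t" "t \<le> r"
  shows "\<psi> r - \<psi> t \<le> r - t"
proof (cases "r = 0")
  case False
  then have r: "0 < r" using assms by simp
  have "r * (\<psi> r - \<psi> t) \<le> (r - t) * \<psi> r"
    using psi_star[OF assms] by (simp add: algebra_simps)
  also have "\<dots> \<le> (r - t) * r"
    using assms psi_le_id[of r] by (intro mult_left_mono) auto
  finally show ?thesis using r by (simp add: mult.commute)
qed (use assms in simp)

text \<open>At a point of differentiability between \<open>r\<close> and
  \<open>min \<beta> s\<close> the tangent has slope at least \<open>\<gamma> > 0\<close>, which
  separates \<open>\<psi> r\<close> from the value there; monotonicity does the rest.\<close>

lemma psi_strict_mono:
  assumes "0 \<le> r" "r < \<beta>" "r < s"
  shows "\<psi> r < \<psi> s"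
proof -
  obtain y D where y: "r < y" "y < min \<beta> s" "(\<psi> has_real_derivative D) (at y within {0..})"
    using psi_differentiable_between[of r "min \<beta> s"] assms by auto
  have "\<gamma> \<le> D" "0 < \<gamma>"
    using derivative_bounds(2)[OF _ y(3)] y assms score by (auto simp: score_function_def)
  then have "0 < D * (y - r)"
    using y by simp
  moreover have "\<psi> r \<le> \<psi> y + D * (r - y)"
    using psi_below_tangent[OF _ y(3)] y assms by simp
  ultimately have "\<psi> r < \<psi> y"
    by (simp add: algebra_simps)
  also have "\<dots> \<le> \<psi> s"
    using psi_mono y assms by simp
  finally show ?thesis .
qed

lemma psi_pos: "0 < x \<Longrightarrow> 0 < \<psi> x"
  using psi_strict_mono[of 0 x] beta_pos psi_zero by simp

section \<open>The primitive of the score\<close>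

lemma rho_zero: "rho \<psi> 0 = 0"
  by (simp add: rho_def)

lemma rho_derivative:
  assumes "0 \<le> x" "x \<le> b"
  shows "(rho \<psi> has_real_derivative \<psi> x) (at x within {0..b})"
  unfolding rho_def
  by (intro integral_has_real_derivative continuous_on_subset[OF psi_continuous])
    (use assms in auto)

lemma rho_derivative_between:
  assumes "0 \<le> a" "a \<le> x" "x \<le> b"
  shows "(rho \<psi> has_real_derivative \<psi> x) (at x within {a..b})"
  using rho_derivative[of x b] assms by (auto elim!: DERIV_subset)

text \<open>Convexity, since the derivative \<open>\<psi>\<close> is nondecreasing.\<close>

lemma rho_above_tangent:
  assumes "0 \<le> r" "0 \<le> s"
  shows "rho \<psi> r + \<psi> r * (s - r) \<le> rho \<psi> s"
proof (cases "r \<le> s")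
  case True
  have "rho \<psi> r - \<psi> r * r \<le> rho \<psi> s - \<psi> r * s"
    by (rule deriv_nonneg_imp_le[OF True, where g' = "\<lambda>x. \<psi> x - \<psi> r"])
      (use assms psi_mono in \<open>auto intro!: derivative_eq_intros rho_derivative_between\<close>)
  then show ?thesis by (simp add: algebra_simps)
next
  case False
  then have "s \<le> r" by simp
  have "\<psi> r * s - rho \<psi> s \<le> \<psi> r * r - rho \<psi> r"
    by (rule deriv_nonneg_imp_le[OF \<open>s \<le> r\<close>, where g' = "\<lambda>x. \<psi> r - \<psi> x"])
      (use assms psi_mono in \<open>auto intro!: derivative_eq_intros rho_derivative_between\<close>)
  then show ?thesis by (simp add: algebra_simps)
qed

lemma rho_nonneg: "0 \<le> x \<Longrightarrow> 0 \<le> rho \<psi> x"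
  using rho_above_tangent[of 0 x] rho_zero psi_zero by simp

lemma rho_mono: "0 \<le> x \<Longrightarrow> x \<le> y \<Longrightarrow> rho \<psi> x \<le> rho \<psi> y"
  using rho_above_tangent[of x y] mult_nonneg_nonneg[OF psi_nonneg[of x], of "y - x"] by linarith

text \<open>Since \<open>\<psi> x / x\<close> is nonincreasing, \<open>\<rho>\<close> is a concave function of the squared radius.\<close>

lemma rho_below_parabola:
  assumes r: "0 < r" and s: "0 \<le> s"
  shows "rho \<psi> s \<le> rho \<psi> r + \<psi> r / (2 * r) * (s\<^sup>2 - r\<^sup>2)"
proof (cases "r \<le> s")
  case True
  have "\<psi> r / (2 * r) * r\<^sup>2 - rho \<psi> r \<le> \<psi> r / (2 * r) * s\<^sup>2 - rho \<psi> s"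
  proof (rule deriv_nonneg_imp_le[OF True, where g' = "\<lambda>x. \<psi> r / r * x - \<psi> x"])
    fix x assume x: "r \<le> x" "x \<le> s"
    then show "0 \<le> \<psi> r / r * x - \<psi> x"
      using psi_star[of r x] r by (simp add: field_simps)
    show "((\<lambda>x. \<psi> r / (2 * r) * x\<^sup>2 - rho \<psi> x) has_real_derivative \<psi> r / r * x - \<psi> x)
        (at x within {r..s})"
      using x r by (auto intro!: derivative_eq_intros rho_derivative_between)
  qed
  then show ?thesis by (simp add: algebra_simps)
next
  case False
  then have "s \<le> r" by simp
  have "rho \<psi> s - \<psi> r / (2 * r) * s\<^sup>2 \<le> rho \<psi> r - \<psi> r / (2 * r) * r\<^sup>2"
  proof (rule deriv_nonneg_imp_le[OF \<open>s \<le> r\<close>, where g' = "\<lambda>x. \<psi> x - \<psi> r / r * x"])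
    fix x assume x: "s \<le> x" "x \<le> r"
    then show "0 \<le> \<psi> x - \<psi> r / r * x"
      using psi_star[of x r] r s by (simp add: field_simps)
    show "((\<lambda>x. rho \<psi> x - \<psi> r / (2 * r) * x\<^sup>2) has_real_derivative \<psi> x - \<psi> r / r * x)
        (at x within {s..r})"
      using x r s by (auto intro!: derivative_eq_intros rho_derivative_between)
  qed
  then show ?thesis by (simp add: algebra_simps)
qed

lemma rho_le_square:
  assumes "0 \<le> x"
  shows "rho \<psi> x \<le> x\<^sup>2 / 2"
proof -
  have "0\<^sup>2 / 2 - rho \<psi> 0 \<le> x\<^sup>2 / 2 - rho \<psi> x"
    by (rule deriv_nonneg_imp_le[OF assms, where g' = "\<lambda>t. t - \<psi> t"])
      (use psi_le_id in \<open>auto intro!: derivative_eq_intros rho_derivative_between\<close>)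
  then show ?thesis by (simp add: rho_zero)
qed

lemma psi_square_le_rho:
  assumes "0 \<le> r"
  shows "(\<psi> r)\<^sup>2 \<le> 2 * rho \<psi> r"
proof -
  \<comment> \<open>\<open>a\<close> is where the line of slope 1 through the graph point at
    \<open>r\<close> meets the axis. As \<open>\<psi>\<close> is 1-Lipschitz it lies above this line
    on \<open>{a..r}\<close>, so \<open>rho\<close> gains at least the area of a right isosceles
    triangle with legs \<open>\<psi> r\<close>.\<close>
  define a where "a = r - \<psi> r"
  have a: "0 \<le> a" "a \<le> r"
    using psi_le_id psi_nonneg assms by (auto simp: a_def)
  have "rho \<psi> a - (a - a)\<^sup>2 / 2 \<le> rho \<psi> r - (r - a)\<^sup>2 / 2"
  proof (rule deriv_nonneg_imp_le[OF a(2), where g' = "\<lambda>t. \<psi> t - (t - a)"])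
    fix t assume t: "a \<le> t" "t \<le> r"
    then show "0 \<le> \<psi> t - (t - a)"
      using psi_diff_le[of t r] a by (simp add: a_def)
    show "((\<lambda>t. rho \<psi> t - (t - a)\<^sup>2 / 2) has_real_derivative \<psi> t - (t - a)) (at t within {a..r})"
      using t a by (auto intro!: derivative_eq_intros rho_derivative_between simp: field_simps)
  qed
  then show ?thesis
    using rho_nonneg[OF a(1)] by (simp add: a_def)
qed

lemma rho_borel: "f \<in> borel_measurable M \<Longrightarrow> (\<And>w. 0 \<le> f w) \<Longrightarrow> (\<lambda>w. rho \<psi> (f w)) \<in> borel_measurable M"
proof -
  assume f: "f \<in> borel_measurable M" "\<And>w. 0 \<le> f w"
  \<comment> \<open>Clipping the argument at 0 makes \<open>rho_mono\<close> applicable on the whole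
    line, and monotone functions are Borel.\<close>
  have "(\<lambda>x. rho \<psi> (max 0 x)) \<in> borel_measurable borel"
    by (intro borel_measurable_mono monoI rho_mono) auto
  from measurable_compose[OF f(1) this] show ?thesis
    using f(2) by (simp add: max_absorb2)
qed

end

text \<open>The gradient of \<open>z \<mapsto> \<rho> \<parallel>z\<parallel>\<close>.\<close>

definition score_vector :: "(real \<Rightarrow> real) \<Rightarrow> 'a::real_inner \<Rightarrow> 'a" where
  "score_vector \<psi> z = (\<psi> (norm z) / norm z) *\<^sub>R z"

section \<open>The score as a vector field: gradient inequalities and monotonicity\<close>

context
  fixes \<psi> :: "real \<Rightarrow> real" and \<beta> \<gamma> :: real
  assumes score: "score_function \<beta> \<gamma> \<psi>"
begin

lemma norm_score_vector: "norm (score_vector \<psi> z) = \<psi> (norm z)"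
  using psi_nonneg[OF score, of "norm z"] psi_zero[OF score]
  by (cases "z = 0") (auto simp: score_vector_def)

text \<open>Only the origin needs care; there the norm of the score is at most
  \<open>norm z\<close>.\<close>

lemma score_vector_continuous: "continuous_on UNIV (score_vector \<psi> :: 'a::real_inner \<Rightarrow> 'a)"
  unfolding continuous_on_eq_continuous_at[OF open_UNIV]
proof
  fix z :: 'a
  show "isCont (score_vector \<psi>) z"
  proof (cases "z = 0")
    case True
    have "(score_vector \<psi> \<longlongrightarrow> 0) (at (0::'a))"
    proof (rule Lim_null_comparison)
      show "\<forall>\<^sub>F x in at 0. norm (score_vector \<psi> x) \<le> norm (x::'a)"
        using psi_le_id[OF score] by (simp add: norm_score_vector)
      show "((\<lambda>x::'a. norm x) \<longlongrightarrow> 0) (at 0)"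
        by (rule tendsto_norm_zero) (rule tendsto_ident_at)
    qed
    with True show ?thesis by (simp add: isCont_def score_vector_def)
  next
    case False
    then have "isCont \<psi> (norm z)"
      using psi_continuous[OF score] by (intro continuous_on_interior[of "{0..}"]) auto
    then have "isCont (\<lambda>x::'a. \<psi> (norm x)) z"
      by (intro isCont_o2[of z norm \<psi>] continuous_norm continuous_ident)
    then show ?thesis
      using False unfolding score_vector_def[abs_def]
      by (intro continuous_scaleR isCont_divide continuous_norm continuous_ident) auto
  qed
qed

text \<open>By Cauchy-Schwarz the norm grows at least as fast as its linearization at
  \<open>z\<close>, and the tangent of \<open>rho\<close> at \<open>norm z\<close> has nonnegative
  slope.\<close>

lemma rho_norm_above_gradient:
  "rho \<psi> (norm z) + score_vector \<psi> z \<bullet> h \<le> rho \<psi> (norm (z + h))"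
proof (cases "z = 0")
  case True
  then show ?thesis
    using rho_nonneg[OF score, of "norm h"] rho_zero[OF score] by (simp add: score_vector_def)
next
  case False
  define r where "r = norm z"
  have r: "0 < r" using False by (simp add: r_def)
  have "r * r + z \<bullet> h = z \<bullet> (z + h)"
    by (simp add: r_def inner_add_right power2_norm_eq_inner[symmetric] power2_eq_square)
  also have "\<dots> \<le> r * norm (z + h)"
    unfolding r_def by (rule norm_cauchy_schwarz)
  finally have "z \<bullet> h / r \<le> norm (z + h) - r"
    using r by (simp add: field_simps)
  then have "\<psi> r * (z \<bullet> h / r) \<le> \<psi> r * (norm (z + h) - r)"
    using psi_nonneg[OF score, of r] r by (intro mult_left_mono) auto
  also have "\<dots> \<le> rho \<psi> (norm (z + h)) - rho \<psi> r"
    using rho_above_tangent[OF score, of r "norm (z + h)"] r by simp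
  finally show ?thesis by (simp add: score_vector_def r_def)
qed

text \<open>The squared norm expands exactly, so \<open>rho_below_parabola\<close> reproduces the
  gradient term; the quadratic remainder has the factor \<open>\<psi> r / r\<close>, which is at
  most 1.\<close>

lemma rho_norm_below_gradient:
  "rho \<psi> (norm (z + h)) \<le> rho \<psi> (norm z) + score_vector \<psi> z \<bullet> h + (norm h)\<^sup>2 / 2"
proof (cases "z = 0")
  case True
  then show ?thesis
    using rho_le_square[OF score, of "norm h"] rho_zero[OF score] by (simp add: score_vector_def)
next
  case False
  define r where "r = norm z"
  have r: "0 < r" using False by (simp add: r_def)
  have eq: "(norm (z + h))\<^sup>2 - r\<^sup>2 = 2 * (z \<bullet> h) + (norm h)\<^sup>2"
    by (simp add: r_def power2_norm_eq_inner inner_simps inner_commute)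
  have "rho \<psi> (norm (z + h)) \<le> rho \<psi> r + \<psi> r / (2 * r) * (2 * (z \<bullet> h) + (norm h)\<^sup>2)"
    using rho_below_parabola[OF score r, of "norm (z + h)"] by (simp add: eq)
  also have "\<dots> = rho \<psi> r + score_vector \<psi> z \<bullet> h + \<psi> r / r * ((norm h)\<^sup>2 / 2)"
    using r by (simp add: score_vector_def flip: r_def) (simp add: field_simps)
  also have "\<psi> r / r * ((norm h)\<^sup>2 / 2) \<le> 1 * ((norm h)\<^sup>2 / 2)"
    using psi_le_id[OF score, of r] r by (intro mult_right_mono) auto
  finally show ?thesis by (simp add: r_def)
qed

text \<open>Reduction to radii: the score at \<open>y\<close> is parallel to \<open>y\<close>, so
  the two diagonal products are exact, and Cauchy-Schwarz bounds the mixed ones.\<close>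

lemma score_vector_inner_diff_ge:
  "(\<psi> (norm y) - \<psi> (norm z)) * (norm y - norm z) \<le> (score_vector \<psi> y - score_vector \<psi> z) \<bullet> (y - z)"
proof -
  have eq: "score_vector \<psi> y \<bullet> y = \<psi> (norm y) * norm y" for y :: 'a
    by (cases "y = 0") (auto simp: score_vector_def power2_norm_eq_inner[symmetric] power2_eq_square)
  have le: "score_vector \<psi> y \<bullet> z \<le> \<psi> (norm y) * norm z" for y z :: 'a
    using norm_cauchy_schwarz[of "score_vector \<psi> y" z] by (simp add: norm_score_vector)
  show ?thesis
    using le[of y z] le[of z y] by (simp add: inner_simps eq algebra_simps)
qed

lemma score_vector_monotone:
  "0 \<le> (score_vector \<psi> y - score_vector \<psi> z) \<bullet> (y - z)"
proof -
  have "0 \<le> (\<psi> (norm y) - \<psi> (norm z)) * (norm y - norm z)"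
    using psi_mono[OF score, of "norm y" "norm z"] psi_mono[OF score, of "norm z" "norm y"]
    by (cases "norm y \<le> norm z") (auto intro: mult_nonneg_nonneg mult_nonpos_nonpos)
  then show ?thesis using score_vector_inner_diff_ge order_trans by blast
qed

text \<open>The radial bound is strict when the norms differ, as the smaller one is below
  \<open>\<beta>\<close>. On a common sphere that bound is 0, but there the score is the identity
  times the positive factor \<open>\<psi> (norm y) / norm y\<close>.\<close>

lemma score_vector_strict_monotone:
  assumes "norm y < \<beta>" "y \<noteq> z"
  shows "0 < (score_vector \<psi> y - score_vector \<psi> z) \<bullet> (y - z)"
proof (cases "norm y = norm z")
  case True
  then have pos: "0 < norm y"
    using assms(2) by auto
  have "(score_vector \<psi> y - score_vector \<psi> z) \<bullet> (y - z) = \<psi> (norm y) / norm y * (norm (y - z))\<^sup>2"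
    using True by (simp add: score_vector_def power2_norm_eq_inner flip: scaleR_diff_right)
  then show ?thesis
    using pos psi_pos[OF score pos] assms(2) by simp
next
  case False
  have "0 < (\<psi> (norm y) - \<psi> (norm z)) * (norm y - norm z)"
    using psi_strict_mono[OF score, of "norm y" "norm z"] psi_strict_mono[OF score, of "norm z" "norm y"]
      assms False by (auto simp: zero_less_mult_iff linorder_neq_iff)
  then show ?thesis using score_vector_inner_diff_ge by (rule less_le_trans)
qed

end

section \<open>Hilbert spaces\<close>

text \<open>Points of almost minimal norm in the sublevel sets form a Cauchy sequence by the
  parallelogram law; this replaces weak compactness.\<close>

lemma midpoint_convex_attains_minimum:
  fixes f :: "'a::{real_inner, banach} \<Rightarrow> real"
  assumes "S \<noteq> {}" "closed S"
    and midS: "\<And>x y. x \<in> S \<Longrightarrow> y \<in> S \<Longrightarrow> (1/2) *\<^sub>R (x + y) \<in> S"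
    and midf: "\<And>x y. x \<in> S \<Longrightarrow> y \<in> S \<Longrightarrow> 2 * f ((1/2) *\<^sub>R (x + y)) \<le> f x + f y"
    and lsc: "\<And>g x c l. g \<longlonglongrightarrow> x \<Longrightarrow> (\<And>n. f (g n) \<le> c n) \<Longrightarrow> c \<longlonglongrightarrow> l \<Longrightarrow> f x \<le> l"
    and a: "0 < a" and coercive: "\<And>x. a * norm x - b \<le> f x"
  shows "\<exists>p\<in>S. \<forall>x\<in>S. f p \<le> f x"
proof -
  define m where "m = Inf (f ` S)"
  have bdd: "bdd_below (f ` S)"
  proof (rule bdd_belowI2)
    show "- b \<le> f x" for x
      using coercive[of x] mult_nonneg_nonneg[OF less_imp_le[OF a] norm_ge_zero[of x]] by linarith
  qed
  have m: "m \<le> f x" if "x \<in> S" for x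
    unfolding m_def using that bdd by (rule cINF_lower[rotated])
  define \<epsilon> where "\<epsilon> n = inverse (real (Suc n))" for n
  have \<epsilon>: "0 < \<epsilon> n" "\<epsilon> n \<le> 1" "k \<le> n \<Longrightarrow> \<epsilon> n \<le> \<epsilon> k" "\<epsilon> \<longlonglongrightarrow> 0" for n k
    unfolding \<epsilon>_def using LIMSEQ_inverse_real_of_nat by (auto intro!: le_imp_inverse_le simp: inverse_le_1_iff)
  define C where "C n = {x \<in> S. f x \<le> m + \<epsilon> n}" for n
  have Cne: "C n \<noteq> {}" for n
  proof -
    have "\<exists>y\<in>f ` S. y < m + \<epsilon> n"
      unfolding m_def using \<epsilon>(1)[of n] \<open>S \<noteq> {}\<close> bdd by (subst cInf_less_iff[symmetric]) auto
    then show ?thesis by (auto simp: C_def intro: less_imp_le)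
  qed
  have Cmid: "(1/2) *\<^sub>R (x + y) \<in> C n" if "x \<in> C n" "y \<in> C n" for x y n
    using that midS[of x y] midf[of x y] by (auto simp: C_def)
  have Canti: "C n \<subseteq> C k" if "k \<le> n" for k n
    using \<epsilon>(3)[OF that] by (auto simp: C_def)
  define r where "r n = Inf ((\<lambda>x. (norm x)\<^sup>2) ` C n)" for n
  have rbdd: "bdd_below ((\<lambda>x. (norm x)\<^sup>2) ` C n)" for n
    by (rule bdd_belowI2[of _ 0]) simp
  have r: "r n \<le> (norm x)\<^sup>2" if "x \<in> C n" for x n
    unfolding r_def using that rbdd by (rule cINF_lower[rotated])
  \<comment> \<open>The sets \<open>C n\<close> shrink, so these infima increase; coercivity bounds
    the points of \<open>C n\<close> uniformly, hence the infima converge.\<close>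
  have "incseq r"
    unfolding r_def by (intro incseq_SucI cINF_superset_mono Cne rbdd Canti) auto
  moreover have "r n \<le> ((m + 1 + b) / a)\<^sup>2" for n
  proof -
    obtain x where x: "x \<in> C n" using Cne by blast
    have "a * norm x \<le> m + 1 + b"
      using x coercive[of x] \<epsilon>(2)[of n] by (auto simp: C_def)
    then have "norm x \<le> (m + 1 + b) / a"
      using a by (simp add: field_simps)
    then have "(norm x)\<^sup>2 \<le> ((m + 1 + b) / a)\<^sup>2"
      by (intro power_mono) auto
    with r[OF x] show ?thesis by linarith
  qed
  ultimately obtain R where R: "r \<longlonglongrightarrow> R" "\<And>n. r n \<le> R"
    using incseq_convergent[of r] by blast
  have "\<exists>x\<in>C n. (norm x)\<^sup>2 < r n + \<epsilon> n" for n
  proof -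
    have "\<exists>y\<in>(\<lambda>x. (norm x)\<^sup>2) ` C n. y < r n + \<epsilon> n"
      unfolding r_def using \<epsilon>(1)[of n] Cne rbdd by (subst cInf_less_iff[symmetric]) auto
    then show ?thesis by blast
  qed
  then obtain p where p: "\<And>n. p n \<in> C n" "\<And>n. (norm (p n))\<^sup>2 < r n + \<epsilon> n"
    by metis
  have near: "(norm (p n - p k))\<^sup>2 \<le> 4 * (R - r k + \<epsilon> k)" if "k \<le> n" for k n
  proof -
    \<comment> \<open>The midpoint stays in the larger sublevel set, so its squared norm is at least
      \<open>r k\<close>. Both points have squared norm at most \<open>R + \<epsilon> k\<close>,
      which leaves little room for their difference.\<close>
    have "(1/2) *\<^sub>R (p n + p k) \<in> C k"
      using p(1) Canti[OF that] by (intro Cmid) auto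
    then have "r k \<le> (norm ((1/2) *\<^sub>R (p n + p k)))\<^sup>2"
      by (rule r)
    then have "4 * r k \<le> (norm (p n + p k))\<^sup>2"
      by (simp add: power_divide)
    moreover have "(norm (p n - p k))\<^sup>2 + (norm (p n + p k))\<^sup>2 = 2 * (norm (p n))\<^sup>2 + 2 * (norm (p k))\<^sup>2"
      unfolding power2_norm_eq_inner by (simp add: inner_simps)
    ultimately show ?thesis
      using p(2)[of n] p(2)[of k] R(2)[of n] R(2)[of k] \<epsilon>(3)[OF that] by argo
  qed
  have "Cauchy p"
  proof (rule CauchyI')
    fix e :: real assume e: "0 < e"
    have "(\<lambda>k. 4 * (R - r k + \<epsilon> k)) \<longlonglongrightarrow> 4 * (R - R + 0)"
      by (intro tendsto_intros R \<epsilon>)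
    then have "\<forall>\<^sub>F k in sequentially. 4 * (R - r k + \<epsilon> k) < e\<^sup>2"
      using e by (intro order_tendstoD(2)) auto
    then obtain K where K: "\<And>k. k \<ge> K \<Longrightarrow> 4 * (R - r k + \<epsilon> k) < e\<^sup>2"
      by (auto simp: eventually_sequentially)
    show "\<exists>K. \<forall>k\<ge>K. \<forall>n>k. dist (p k) (p n) < e"
    proof (intro exI allI impI)
      fix k n assume kn: "K \<le> k" "k < n"
      have "(norm (p k - p n))\<^sup>2 < e\<^sup>2"
        using near[of k n] K[of k] kn by (simp add: norm_minus_commute)
      then show "dist (p k) (p n) < e"
        unfolding dist_norm by (rule power_less_imp_less_base) (use e in simp)
    qed
  qed
  then obtain q where q: "p \<longlonglongrightarrow> q"
    using Cauchy_convergent convergent_def by blast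
  have "q \<in> S"
    using \<open>closed S\<close> p(1) q unfolding closed_sequential_limits C_def by blast
  moreover have "f q \<le> m"
  proof (rule lsc[OF q])
    show "f (p n) \<le> m + \<epsilon> n" for n
      using p(1) by (auto simp: C_def)
    show "(\<lambda>n. m + \<epsilon> n) \<longlonglongrightarrow> m"
      using tendsto_add[OF tendsto_const \<epsilon>(4), of m] by simp
  qed
  ultimately show ?thesis
    using m by (meson order_trans)
qed

section \<open>Bessel's inequality, orthogonal projection and orthonormal bases\<close>

lemma norm_diff_sum_orthonormal:
  fixes x :: "'a::real_inner"
  assumes "finite F" "pairwise orthogonal F" "\<And>e. e \<in> F \<Longrightarrow> norm e = 1"
  shows "(norm (x - (\<Sum>e\<in>F. c e *\<^sub>R e)))\<^sup>2 =
    (norm x)\<^sup>2 - (\<Sum>e\<in>F. (x \<bullet> e)\<^sup>2) + (\<Sum>e\<in>F. (x \<bullet> e - c e)\<^sup>2)"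
  using assms
proof (induction F rule: finite_induct)
  case (insert e F)
  define y where "y = (\<Sum>e\<in>F. c e *\<^sub>R e)"
  \<comment> \<open>The new vector is orthogonal to the partial sum, so the square can be completed
    in its coordinate alone.\<close>
  have "y \<bullet> e = 0"
    using insert.prems insert.hyps unfolding y_def inner_sum_left
    by (intro sum.neutral) (auto simp: pairwise_insert orthogonal_def)
  moreover have "e \<bullet> e = 1"
    using insert.prems by (metis insertI1 norm_eq_1)
  ultimately have "(norm (x - (c e *\<^sub>R e + y)))\<^sup>2 = (norm (x - y))\<^sup>2 - (x \<bullet> e)\<^sup>2 + (x \<bullet> e - c e)\<^sup>2"
    unfolding power2_norm_eq_inner by (simp add: inner_simps inner_commute power2_eq_square algebra_simps)
  then show ?case
    using insert by (simp add: y_def pairwise_insert)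
qed simp

lemma bessel_inequality:
  fixes x :: "'a::real_inner"
  assumes "finite F" "pairwise orthogonal F" "\<And>e. e \<in> F \<Longrightarrow> norm e = 1"
  shows "(\<Sum>e\<in>F. (x \<bullet> e)\<^sup>2) \<le> (norm x)\<^sup>2"
  using norm_diff_sum_orthonormal[OF assms, of x "\<lambda>e. x \<bullet> e"]
    zero_le_power2[of "norm (x - (\<Sum>e\<in>F. (x \<bullet> e) *\<^sub>R e))"] by simp

text \<open>The Fourier sum is the best approximation from \<open>span F\<close>; any approximation
  of \<open>x\<close> by that span thus gives a lower bound for the partial Parseval sum.\<close>

lemma bessel_defect_le_dist:
  fixes x :: "'a::real_inner"
  assumes "finite F" "pairwise orthogonal F" "\<And>e. e \<in> F \<Longrightarrow> norm e = 1" "y \<in> span F"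
  shows "(norm x)\<^sup>2 - (\<Sum>e\<in>F. (x \<bullet> e)\<^sup>2) \<le> (norm (x - y))\<^sup>2"
proof -
  obtain c where "y = (\<Sum>e\<in>F. c e *\<^sub>R e)"
    using assms(1,4) by (auto simp: span_finite)
  then show ?thesis
    using norm_diff_sum_orthonormal[OF assms(1-3), of x c]
      sum_nonneg[of F "\<lambda>e. (x \<bullet> e - c e)\<^sup>2"] by simp
qed

text \<open>Projection theorem: for \<open>x\<close> outside the closed span, subtract its nearest
  point there and normalize the difference.\<close>

lemma orthogonal_unit_vector_exists:
  fixes B :: "'a::{real_inner, banach} set"
  assumes "closure (span B) \<noteq> UNIV"
  shows "\<exists>u. norm u = 1 \<and> (\<forall>e\<in>B. u \<bullet> e = 0)"
proof -
  obtain x where x: "x \<notin> closure (span B)" using assms by auto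
  let ?S = "closure (span B)"
  have sub: "subspace ?S"
    unfolding subspace_def
  proof (intro conjI ballI allI)
    show "0 \<in> ?S" using closure_subset span_zero by blast
    show "y + z \<in> ?S" if yz: "y \<in> ?S" "z \<in> ?S" for y z
    proof -
      obtain g h where "\<forall>n. g n \<in> span B" "g \<longlonglongrightarrow> y" "\<forall>n. h n \<in> span B" "h \<longlonglongrightarrow> z"
        using yz unfolding closure_sequential by blast
      then show ?thesis
        unfolding closure_sequential by (intro exI[of _ "\<lambda>n. g n + h n"] conjI tendsto_add) (auto intro: span_add)
    qed
    show "c *\<^sub>R y \<in> ?S" if y: "y \<in> ?S" for c y
    proof -
      obtain g where "\<forall>n. g n \<in> span B" "g \<longlonglongrightarrow> y"
        using y unfolding closure_sequential by blast
      then show ?thesis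
        unfolding closure_sequential by (intro exI[of _ "\<lambda>n. c *\<^sub>R g n"] conjI tendsto_intros) (auto intro: span_scale)
    qed
  qed
  have "\<exists>p\<in>?S. \<forall>y\<in>?S. norm (p - x) \<le> norm (y - x)"
  proof (rule midpoint_convex_attains_minimum[where a = 1 and b = "norm x"])
    show "?S \<noteq> {}" using sub subspace_0 by blast
    show "(1/2) *\<^sub>R (y + z) \<in> ?S" if "y \<in> ?S" "z \<in> ?S" for y z
      using sub that by (intro subspace_scale subspace_add)
    show "2 * norm ((1/2) *\<^sub>R (y + z) - x) \<le> norm (y - x) + norm (z - x)" for y z
    proof -
      have "2 * norm ((1/2) *\<^sub>R (y + z) - x) = norm (2 *\<^sub>R ((1/2) *\<^sub>R (y + z) - x))"
        by simp
      also have "2 *\<^sub>R ((1/2) *\<^sub>R (y + z) - x) = (y - x) + (z - x)"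
        by (simp add: algebra_simps scaleR_2)
      finally show ?thesis using norm_triangle_ineq[of "y - x" "z - x"] by simp
    qed
    show "norm (y - x) \<le> l" if "g \<longlonglongrightarrow> y" "\<And>n. norm (g n - x) \<le> c n" "c \<longlonglongrightarrow> l" for g y c l
    proof (rule LIMSEQ_le[of "\<lambda>n. norm (g n - x)" _ c])
      show "(\<lambda>n. norm (g n - x)) \<longlonglongrightarrow> norm (y - x)"
        by (intro tendsto_intros that)
    qed (use that in auto)
    show "1 * norm y - norm x \<le> norm (y - x)" for y
      using norm_triangle_ineq2[of y x] by simp
  qed auto
  then obtain p where p: "p \<in> ?S" "\<And>y. y \<in> ?S \<Longrightarrow> norm (p - x) \<le> norm (y - x)" by blast
  define v where "v = x - p"
  have "v \<noteq> 0" using p x by (auto simp: v_def)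
  have v: "v \<bullet> e = 0" if "e \<in> B" for e
  proof (cases "e = 0")
    case False
    \<comment> \<open>The coefficient minimizing \<open>norm (v - c *\<^sub>R e)\<close>. Moving
      \<open>p\<close> along \<open>e\<close> by it cannot bring \<open>p\<close> closer to
      \<open>x\<close>, which forces \<open>v \<bullet> e = 0\<close>.\<close>
    define c where "c = (v \<bullet> e) / (e \<bullet> e)"
    have "e \<in> ?S" using that closure_subset span_base by blast
    then have "p + c *\<^sub>R e \<in> ?S"
      using sub p(1) by (intro subspace_add subspace_scale)
    then have "norm v \<le> norm (v - c *\<^sub>R e)"
      using p(2)[of "p + c *\<^sub>R e"] by (simp add: v_def norm_minus_commute algebra_simps)
    then have "v \<bullet> v \<le> (v - c *\<^sub>R e) \<bullet> (v - c *\<^sub>R e)"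
      by (simp add: norm_le)
    also have "\<dots> = v \<bullet> v - (v \<bullet> e)\<^sup>2 / (e \<bullet> e)"
      using False by (simp add: inner_simps inner_commute c_def power2_eq_square field_simps)
    finally have "(v \<bullet> e)\<^sup>2 / (e \<bullet> e) \<le> 0" by simp
    moreover have "0 < e \<bullet> e" using False by simp
    ultimately show ?thesis by (auto simp: divide_le_0_iff)
  qed simp
  show ?thesis
    using \<open>v \<noteq> 0\<close> v by (intro exI[of _ "v /\<^sub>R norm v"]) auto
qed

text \<open>A maximal orthonormal set exists by Zorn's lemma; if its span were not dense, an
  orthogonal unit vector would enlarge it. This gives meaning to the \<open>SOME\<close> in
  \<open>op_trace\<close>.\<close>

lemma orthonormal_basis_exists: "\<exists>B::'a::{real_inner, banach} set. orthonormal_basis B"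
proof -
  let ?A = "{B::'a set. pairwise orthogonal B \<and> (\<forall>e\<in>B. norm e = 1)}"
  have "\<exists>B\<in>?A. \<forall>C\<in>?A. B \<subseteq> C \<longrightarrow> C = B"
  proof (rule subset_Zorn)
    fix \<C> assume "subset.chain ?A \<C>"
    then have C: "\<C> \<subseteq> ?A" and chain: "\<And>X Y. X \<in> \<C> \<Longrightarrow> Y \<in> \<C> \<Longrightarrow> X \<subseteq> Y \<or> Y \<subseteq> X"
      by (auto simp: subset_chain_def)
    have "pairwise orthogonal (\<Union>\<C>)"
    proof (rule pairwiseI)
      fix x y assume "x \<in> \<Union>\<C>" "y \<in> \<Union>\<C>" "x \<noteq> y"
      then obtain X where "X \<in> \<C>" "x \<in> X" "y \<in> X" using chain by blast
      then show "orthogonal x y" using C \<open>x \<noteq> y\<close> by (auto simp: pairwise_def)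
    qed
    then show "\<exists>U\<in>?A. \<forall>X\<in>\<C>. X \<subseteq> U"
      using C by (intro bexI[of _ "\<Union>\<C>"]) auto
  qed
  then obtain B :: "'a set" where B: "pairwise orthogonal B" "\<forall>e\<in>B. norm e = 1"
    and max: "\<forall>C. pairwise orthogonal C \<longrightarrow> (\<forall>e\<in>C. norm e = 1) \<longrightarrow> B \<subseteq> C \<longrightarrow> C = B"
    by auto
  have "closure (span B) = UNIV"
  proof (rule ccontr)
    assume "\<not> ?thesis"
    then obtain u where u: "norm u = 1" "\<forall>e\<in>B. u \<bullet> e = 0"
      using orthogonal_unit_vector_exists by blast
    have "insert u B = B"
      by (rule max[rule_format]) (use B u in \<open>auto simp: pairwise_insert orthogonal_def inner_commute\<close>)
    then have "u \<bullet> u = 0" using u by blast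
    then show False using u by simp
  qed
  with B show ?thesis unfolding orthonormal_basis_def by blast
qed

text \<open>The hypothesis has the shape that \<open>2 a b \<le> a^2 + b^2\<close> yields for
  second-moment forms; testing it in the direction of \<open>A u\<close> recovers the operator
  norm.\<close>

lemma norm_blinfun_le_of_form_bound:
  fixes A :: "'a::real_inner \<Rightarrow>\<^sub>L 'a"
  assumes c: "0 \<le> c" and form: "\<And>u v. 2 * (A u \<bullet> v) \<le> c * ((norm u)\<^sup>2 + (norm v)\<^sup>2)"
  shows "norm A \<le> c"
proof (rule norm_blinfun_bound[OF c])
  fix u
  show "norm (A u) \<le> c * norm u"
  proof (cases "A u = 0")
    case False
    then have u: "u \<noteq> 0" by (auto simp: blinfun.zero_right)
    \<comment> \<open>\<open>A u\<close> rescaled to the length of \<open>u\<close>, which balances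
      the two squares in the hypothesis.\<close>
    define v where "v = (norm u / norm (A u)) *\<^sub>R A u"
    have "norm v = norm u" "A u \<bullet> v = norm u * norm (A u)"
      using False by (auto simp: v_def power2_norm_eq_inner[symmetric] power2_eq_square)
    then have "norm u * norm (A u) \<le> norm u * (c * norm u)"
      using form[of u v] by (simp add: power2_eq_square algebra_simps)
    then show ?thesis using u by simp
  qed (use c in simp)
qed

lemma outer_continuous: "continuous_on UNIV (\<lambda>x::'a::real_inner. outer x x)"
proof -
  have "continuous_on UNIV (\<lambda>x::'a. blinfun_scaleR_left x)" "continuous_on UNIV (\<lambda>x::'a. blinfun_inner_right x)"
    by (intro linear_continuous_on bounded_linear_blinfun_scaleR_left bounded_linear_blinfun_inner_right)+
  then show ?thesis
    unfolding outer_def by (intro bounded_bilinear.continuous_on[OF bounded_bilinear_blinfun_compose])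
qed

lemma norm_outer_le: "norm (outer x y) \<le> norm x * norm y"
proof (rule norm_blinfun_bound)
  fix u
  show "norm (outer x y u) \<le> norm x * norm y * norm u"
    using mult_right_mono[OF Cauchy_Schwarz_ineq2[of y u] norm_ge_zero[of x]]
    by (simp add: algebra_simps)
qed simp

section \<open>Second moments and the location estimator\<close>

text \<open>\<open>V\<close> will be the range of a simple function: even for an uncountable
  \<open>B\<close>, finitely many basis vectors then suffice up to
  \<open>\<epsilon>\<close>.\<close>

lemma orthonormal_basis_finite_approximation:
  fixes B :: "'a::real_inner set"
  assumes B: "orthonormal_basis B" and "0 < \<epsilon>" and "finite V"
  shows "\<exists>F. finite F \<and> F \<subseteq> B \<and> (\<forall>v\<in>V. \<exists>y\<in>span F. norm (v - y) < \<epsilon>)"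
  using \<open>finite V\<close>
proof (induction V rule: finite_induct)
  case (insert v V)
  then obtain F where F: "finite F" "F \<subseteq> B" "\<forall>v\<in>V. \<exists>y\<in>span F. norm (v - y) < \<epsilon>"
    by blast
  have "v \<in> closure (span B)"
    using B by (simp add: orthonormal_basis_def)
  then obtain y where y: "y \<in> span B" "norm (v - y) < \<epsilon>"
    using \<open>0 < \<epsilon>\<close> by (auto simp: closure_approachable dist_norm norm_minus_commute)
  then obtain t c where t: "finite t" "t \<subseteq> B" "y = (\<Sum>e\<in>t. c e *\<^sub>R e)"
    by (auto simp: span_explicit)
  have "y \<in> span (F \<union> t)"
    unfolding t(3) by (intro span_sum span_scale span_base) auto
  moreover have "span F \<subseteq> span (F \<union> t)"
    by (intro span_mono) auto
  ultimately show ?case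
    using F t(1,2) y(2) by (intro exI[of _ "F \<union> t"]) blast
qed auto

section \<open>Second-moment and covariance operators of a square integrable variable\<close>

locale square_integrable = prob_space M for M :: "'w measure" +
  fixes X :: "'w \<Rightarrow> 'a::{real_inner, banach}"
  assumes strong: "strongly_measurable M X"
    and square: "integrable M (\<lambda>w. (norm (X w))\<^sup>2)"
begin

lemma continuous_compose_borel:
  fixes g :: "'a \<Rightarrow> 'b::topological_space"
  assumes "continuous_on UNIV g"
  shows "(\<lambda>w. g (X w)) \<in> borel_measurable M"
  using strong borel_measurable_continuous_onI[OF assms] unfolding strongly_measurable_def
  by (blast intro: measurable_compose)

lemma integrable_norm: "integrable M (\<lambda>w. norm (X w))"
proof (rule Bochner_Integration.integrable_bound)
  show "integrable M (\<lambda>w. 1 + (norm (X w))\<^sup>2)"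
    using square by simp
  have "x \<le> 1 + x\<^sup>2" for x :: real
    using zero_le_power2[of "x - 1/2"] by (simp add: power2_eq_square algebra_simps)
  then show "AE w in M. norm (norm (X w)) \<le> norm (1 + (norm (X w))\<^sup>2)"
    by (intro AE_I2) (simp add: add_nonneg_nonneg)
qed (intro continuous_compose_borel continuous_intros)

lemma has_bexp_bexp: "has_bexp M X (bexp M X)"
  using has_bexp_exists[OF strong integrable_norm] bexp_eqI by metis

lemma has_bochner_integral_inner:
  "has_bochner_integral M (\<lambda>w. X w \<bullet> u) (bexp M X \<bullet> u)"
  using has_bexp_bounded_linear[OF bounded_linear_inner_left has_bexp_bexp]
  by (simp add: has_bexp_iff_library)

lemma integrable_inner_mult: "integrable M (\<lambda>w. (X w \<bullet> u) * (X w \<bullet> v))"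
proof (rule Bochner_Integration.integrable_bound)
  show "integrable M (\<lambda>w. norm u * norm v * (norm (X w))\<^sup>2)"
    using square by simp
  have "norm ((x \<bullet> u) * (x \<bullet> v)) \<le> norm (norm u * norm v * (norm x)\<^sup>2)" for x :: 'a
  proof -
    have "norm ((x \<bullet> u) * (x \<bullet> v)) \<le> (norm x * norm u) * (norm x * norm v)"
      unfolding real_norm_def abs_mult by (intro mult_mono Cauchy_Schwarz_ineq2) auto
    then show ?thesis by (simp add: power2_eq_square ac_simps)
  qed
  then show "AE w in M. norm ((X w \<bullet> u) * (X w \<bullet> v)) \<le> norm (norm u * norm v * (norm (X w))\<^sup>2)"
    by (rule AE_I2)
qed (intro continuous_compose_borel continuous_intros)

lemma integrable_inner_square: "integrable M (\<lambda>w. (X w \<bullet> u)\<^sup>2)"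
  using integrable_inner_mult[of u u] by (simp add: power2_eq_square)

text \<open>Evaluation at \<open>u\<close> followed by pairing with \<open>v\<close> is a bounded
  linear functional of the operator, so it passes through the expectation.\<close>

lemma second_moment_form:
  "blinfun_apply (bexp M (\<lambda>w. outer (X w) (X w))) u \<bullet> v = (\<integral>w. (X w \<bullet> u) * (X w \<bullet> v) \<partial>M)"
proof -
  have "integrable M (\<lambda>w. norm (outer (X w) (X w)))"
  proof (rule Bochner_Integration.integrable_bound[OF square])
    show "AE w in M. norm (norm (outer (X w) (X w))) \<le> norm ((norm (X w))\<^sup>2)"
      using norm_outer_le by (auto simp: power2_eq_square)
  qed (intro continuous_compose_borel continuous_on_norm outer_continuous)
  then have "\<exists>A. has_bexp M (\<lambda>w. outer (X w) (X w)) A"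
    by (intro has_bexp_exists strongly_measurable_compose[OF strong outer_continuous])
  then have A: "has_bexp M (\<lambda>w. outer (X w) (X w)) (bexp M (\<lambda>w. outer (X w) (X w)))"
    using bexp_eqI by metis
  have "bounded_linear (\<lambda>A::'a \<Rightarrow>\<^sub>L 'a. blinfun_apply A u \<bullet> v)"
    by (intro bounded_linear_inner_left_comp blinfun.bounded_linear_left)
  from has_bexp_bounded_linear[OF this A] show ?thesis
    by (simp add: has_bexp_iff_library has_bochner_integral_iff inner_commute)
qed

text \<open>Bessel bounds every finite partial sum from above. Conversely, finite subsets of
  \<open>B\<close> that nearly span the ranges of simple approximants of \<open>X\<close> give
  partial sums tending to the full second moment. Only finite sums are exchanged with the integral,
  which suits an uncountable \<open>B\<close>.\<close>

lemma expectation_parseval: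
  assumes B: "orthonormal_basis B"
  shows "((\<lambda>e. \<integral>w. (X w \<bullet> e)\<^sup>2 \<partial>M) has_sum (\<integral>w. (norm (X w))\<^sup>2 \<partial>M)) B"
proof -
  let ?m = "\<lambda>e. \<integral>w. (X w \<bullet> e)\<^sup>2 \<partial>M" and ?E = "\<integral>w. (norm (X w))\<^sup>2 \<partial>M"
  have on: "pairwise orthogonal F" "\<And>e. e \<in> F \<Longrightarrow> norm e = 1" if "F \<subseteq> B" for F
    using B that by (auto simp: orthonormal_basis_def intro: pairwise_subset)
  have sum_eq: "sum ?m F = (\<integral>w. (\<Sum>e\<in>F. (X w \<bullet> e)\<^sup>2) \<partial>M)" for F
    by (subst Bochner_Integration.integral_sum) (auto intro: integrable_inner_square)
  have upper: "sum ?m F \<le> ?E" if "finite F" "F \<subseteq> B" for F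
    unfolding sum_eq using on[OF that(2)] that(1)
    by (intro integral_mono bessel_inequality square Bochner_Integration.integrable_sum
        integrable_inner_square) auto
  obtain s where s: "\<And>i. simple_function M (s i)"
    and lim: "AE w in M. (\<lambda>i::nat. s i w) \<longlonglongrightarrow> X w"
    using strong unfolding strongly_measurable_def by blast
  have "\<exists>F. finite F \<and> F \<subseteq> B \<and>
      (\<forall>v\<in>s i ` space M. \<exists>y\<in>span F. norm (v - y) < inverse (real (Suc i)))" for i
    using s by (intro orthonormal_basis_finite_approximation B) (auto simp: simple_function_def)
  then obtain F where F: "\<And>i. finite (F i)" "\<And>i. F i \<subseteq> B"
    "\<And>i v. v \<in> s i ` space M \<Longrightarrow> \<exists>y\<in>span (F i). norm (v - y) < inverse (real (Suc i))"
    by metis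
  have on_F: "pairwise orthogonal (F i)" "\<And>e. e \<in> F i \<Longrightarrow> norm e = 1" for i
    using on[OF F(2)] by blast+
  have "(\<lambda>i. \<integral>w. (\<Sum>e\<in>F i. (X w \<bullet> e)\<^sup>2) \<partial>M) \<longlonglongrightarrow> ?E"
  proof (rule integral_dominated_convergence[where w = "\<lambda>w. (norm (X w))\<^sup>2"])
    show "AE w in M. (\<lambda>i. \<Sum>e\<in>F i. (X w \<bullet> e)\<^sup>2) \<longlonglongrightarrow> (norm (X w))\<^sup>2"
      using lim AE_space
    proof eventually_elim
      fix w assume w: "(\<lambda>i. s i w) \<longlonglongrightarrow> X w" "w \<in> space M"
      \<comment> \<open>\<open>s i w\<close> is within \<open>inverse (real (Suc i))\<close> of some
        \<open>y\<close> in \<open>span (F i)\<close>; the Fourier sum over \<open>F i\<close>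
        approximates \<open>X w\<close> at least as well as \<open>y\<close> does.\<close>
      have defect: "(norm (X w))\<^sup>2 - (norm (X w - s i w) + inverse (real (Suc i)))\<^sup>2 \<le> (\<Sum>e\<in>F i. (X w \<bullet> e)\<^sup>2)" for i
      proof -
        obtain y where y: "y \<in> span (F i)" "norm (s i w - y) < inverse (real (Suc i))"
          using F(3) w(2) by blast
        have "norm (X w - y) \<le> norm (X w - s i w) + inverse (real (Suc i))"
          using norm_triangle_ineq[of "X w - s i w" "s i w - y"] y(2) by simp
        then have "(norm (X w - y))\<^sup>2 \<le> (norm (X w - s i w) + inverse (real (Suc i)))\<^sup>2"
          by (intro power_mono) auto
        moreover have "(norm (X w))\<^sup>2 - (\<Sum>e\<in>F i. (X w \<bullet> e)\<^sup>2) \<le> (norm (X w - y))\<^sup>2"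
          by (rule bessel_defect_le_dist[OF F(1) on_F(1) _ y(1)]) (rule on_F(2))
        ultimately show ?thesis by linarith
      qed
      show "(\<lambda>i. \<Sum>e\<in>F i. (X w \<bullet> e)\<^sup>2) \<longlonglongrightarrow> (norm (X w))\<^sup>2"
      proof (rule tendsto_sandwich[OF _ _ _ tendsto_const])
        have "(\<lambda>i. (norm (X w))\<^sup>2 - (norm (X w - s i w) + inverse (real (Suc i)))\<^sup>2)
            \<longlonglongrightarrow> (norm (X w))\<^sup>2 - (norm (X w - X w) + 0)\<^sup>2"
          by (intro tendsto_intros w LIMSEQ_inverse_real_of_nat)
        then show "(\<lambda>i. (norm (X w))\<^sup>2 - (norm (X w - s i w) + inverse (real (Suc i)))\<^sup>2)
            \<longlonglongrightarrow> (norm (X w))\<^sup>2" by simp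
        show "\<forall>\<^sub>F i in sequentially. (\<Sum>e\<in>F i. (X w \<bullet> e)\<^sup>2) \<le> (norm (X w))\<^sup>2"
          using bessel_inequality[OF F(1) on_F] by simp
      qed (use defect in simp)
    qed
    show "AE w in M. norm (\<Sum>e\<in>F i. (X w \<bullet> e)\<^sup>2) \<le> (norm (X w))\<^sup>2" for i
      using bessel_inequality[OF F(1) on_F] by (simp add: sum_nonneg)
  qed (use square integrable_inner_square in auto)
  then have lower: "(\<lambda>i. sum ?m (F i)) \<longlonglongrightarrow> ?E"
    by (simp only: sum_eq)
  have bdd: "bdd_above (sum ?m ` {F. finite F \<and> F \<subseteq> B})"
    using upper by (intro bdd_aboveI2) auto
  \<comment> \<open>The terms are nonnegative, so the unordered sum is the supremum of the finite
    partial sums.\<close>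
  have "(?m has_sum Sup (sum ?m ` {F. finite F \<and> F \<subseteq> B})) B"
    by (rule nonneg_bdd_above_has_sum) (use bdd in \<open>simp_all add: conj_commute\<close>)
  moreover have "Sup (sum ?m ` {F. finite F \<and> F \<subseteq> B}) = ?E"
  proof (rule antisym)
    show "Sup (sum ?m ` {F. finite F \<and> F \<subseteq> B}) \<le> ?E"
      using upper by (intro cSUP_least) auto
    show "?E \<le> Sup (sum ?m ` {F. finite F \<and> F \<subseteq> B})"
      using F bdd by (intro LIMSEQ_le_const2[OF lower] exI[of _ 0] allI impI cSUP_upper) auto
  qed
  ultimately show ?thesis by simp
qed

lemma op_trace_second_moment:
  "op_trace (bexp M (\<lambda>w. outer (X w) (X w))) = (\<integral>w. (norm (X w))\<^sup>2 \<partial>M)"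
proof -
  let ?B = "SOME B::'a set. orthonormal_basis B"
  have "orthonormal_basis ?B"
    using orthonormal_basis_exists by (rule someI_ex)
  from expectation_parseval[OF this] show ?thesis
    unfolding op_trace_def second_moment_form by (intro infsumI) (simp add: power2_eq_square)
qed

text \<open>Applying \<open>2 a b \<le> a^2 + b^2\<close> under the integral lets the diagonal of
  the form control its off-diagonal values.\<close>

lemma norm_second_moment_le:
  assumes "0 \<le> c" and "\<And>u. (\<integral>w. (X w \<bullet> u)\<^sup>2 \<partial>M) \<le> c * (norm u)\<^sup>2"
  shows "norm (bexp M (\<lambda>w. outer (X w) (X w))) \<le> c"
proof (rule norm_blinfun_le_of_form_bound[OF assms(1)])
  fix u v
  have "2 * (\<integral>w. (X w \<bullet> u) * (X w \<bullet> v) \<partial>M) = (\<integral>w. 2 * ((X w \<bullet> u) * (X w \<bullet> v)) \<partial>M)"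
    by simp
  also have "\<dots> \<le> (\<integral>w. (X w \<bullet> u)\<^sup>2 + (X w \<bullet> v)\<^sup>2 \<partial>M)"
    using sum_squares_bound
    by (intro integral_mono integrable_mult_right Bochner_Integration.integrable_add
        integrable_inner_mult integrable_inner_square) (auto simp: mult.assoc)
  also have "\<dots> = (\<integral>w. (X w \<bullet> u)\<^sup>2 \<partial>M) + (\<integral>w. (X w \<bullet> v)\<^sup>2 \<partial>M)"
    by (intro Bochner_Integration.integral_add integrable_inner_square)
  also have "\<dots> \<le> c * ((norm u)\<^sup>2 + (norm v)\<^sup>2)"
    using assms(2)[of u] assms(2)[of v] by (simp add: algebra_simps)
  finally show "2 * (blinfun_apply (bexp M (\<lambda>w. outer (X w) (X w))) u \<bullet> v) \<le> c * ((norm u)\<^sup>2 + (norm v)\<^sup>2)"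
    by (simp add: second_moment_form)
qed

text \<open>Covers both the shifted variable \<open>X - a\<close> and its score vector, so the
  results of this locale apply to each of them.\<close>

lemma square_integrable_dominated:
  assumes "continuous_on UNIV g" and "\<And>x. norm (g x) \<le> norm (x - a)"
  shows "square_integrable M (\<lambda>w. g (X w) :: 'a)"
proof
  show "strongly_measurable M (\<lambda>w. g (X w))"
    using strong assms(1) by (rule strongly_measurable_compose)
  show "integrable M (\<lambda>w. (norm (g (X w)))\<^sup>2)"
  proof (rule Bochner_Integration.integrable_bound)
    show "integrable M (\<lambda>w. 2 * (norm (X w))\<^sup>2 + 2 * (norm a)\<^sup>2)"
      using square by simp
    have "(norm (g x))\<^sup>2 \<le> 2 * (norm x)\<^sup>2 + 2 * (norm a)\<^sup>2" for x
    proof -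
      have "(norm (g x))\<^sup>2 \<le> (norm x + norm a)\<^sup>2"
        using assms(2)[of x] norm_triangle_ineq4[of x a] by (intro power_mono) auto
      also have "\<dots> \<le> 2 * (norm x)\<^sup>2 + 2 * (norm a)\<^sup>2"
        using sum_squares_bound[of "norm x" "norm a"] by (simp add: power2_sum)
      finally show ?thesis .
    qed
    then show "AE w in M. norm ((norm (g (X w)))\<^sup>2) \<le> norm (2 * (norm (X w))\<^sup>2 + 2 * (norm a)\<^sup>2)"
      by simp
  qed (intro continuous_compose_borel continuous_intros assms)
qed

lemma square_integrable_diff: "square_integrable M (\<lambda>w. X w - a)"
  by (rule square_integrable_dominated[of _ a]) (auto intro!: continuous_intros)

text \<open>Bias-variance decomposition in the direction \<open>u\<close>: after centring at the
  mean, the cross term integrates to 0.\<close>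

lemma covariance_form:
  "(\<integral>w. ((X w - a) \<bullet> u)\<^sup>2 \<partial>M) =
    blinfun_apply (covariance_operator M X) u \<bullet> u + ((bexp M X - a) \<bullet> u)\<^sup>2"
proof -
  let ?m = "bexp M X"
  have zero: "has_bochner_integral M (\<lambda>w. (X w - ?m) \<bullet> u) 0"
    using has_bochner_integral_diff[OF has_bochner_integral_inner[of u],
        of "\<lambda>_. ?m \<bullet> u" "?m \<bullet> u"] has_bochner_integral_integrable[of M "\<lambda>_. ?m \<bullet> u"]
    by (simp add: inner_diff_left prob_space)
  have sq: "integrable M (\<lambda>w. ((X w - ?m) \<bullet> u)\<^sup>2)"
    by (rule square_integrable.integrable_inner_square[OF square_integrable_diff])
  have "((X w - a) \<bullet> u)\<^sup>2 = ((X w - ?m) \<bullet> u)\<^sup>2 +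
      (2 * ((?m - a) \<bullet> u) * ((X w - ?m) \<bullet> u) + ((?m - a) \<bullet> u)\<^sup>2)" for w
    by (simp add: inner_diff_left power2_eq_square algebra_simps)
  then have "(\<integral>w. ((X w - a) \<bullet> u)\<^sup>2 \<partial>M) = (\<integral>w. ((X w - ?m) \<bullet> u)\<^sup>2 \<partial>M) +
      (2 * ((?m - a) \<bullet> u) * (\<integral>w. (X w - ?m) \<bullet> u \<partial>M) + ((?m - a) \<bullet> u)\<^sup>2)"
    using sq zero by (simp add: has_bochner_integral_iff prob_space)
  also have "(\<integral>w. ((X w - ?m) \<bullet> u)\<^sup>2 \<partial>M) = blinfun_apply (covariance_operator M X) u \<bullet> u"
    unfolding covariance_operator_def
      square_integrable.second_moment_form[OF square_integrable_diff] by (simp add: power2_eq_square)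
  finally show ?thesis
    using zero by (simp add: has_bochner_integral_iff)
qed

lemma op_trace_covariance: "op_trace (covariance_operator M X) = (\<integral>w. (norm (X w - bexp M X))\<^sup>2 \<partial>M)"
  unfolding covariance_operator_def
  by (rule square_integrable.op_trace_second_moment[OF square_integrable_diff])

end

section \<open>The location as minimizer of the objective, and the two bounds\<close>

locale score_estimation = square_integrable M X
  for M :: "'w measure" and X :: "'w \<Rightarrow> 'a::{real_inner, banach}" +
  fixes \<psi> :: "real \<Rightarrow> real" and \<beta> \<gamma> :: real
  assumes score: "score_function \<beta> \<gamma> \<psi>"
begin

definition objective :: "'a \<Rightarrow> real" where
  "objective \<theta> = (\<integral>w. rho \<psi> (norm (X w - \<theta>)) \<partial>M)"

text \<open>Minus the gradient of \<open>objective\<close>, because \<open>\<theta>\<close> enters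
  through \<open>X w - \<theta>\<close>.\<close>

definition mean_score :: "'a \<Rightarrow> 'a" where
  "mean_score \<theta> = bexp M (\<lambda>w. score_vector \<psi> (X w - \<theta>))"

lemma location_eq: "location \<psi> M X = (THE \<theta>. has_bexp M (\<lambda>w. score_vector \<psi> (X w - \<theta>)) 0)"
  by (simp add: location_def score_vector_def)

lemma norm_diff_borel: "(\<lambda>w. norm (X w - \<theta>)) \<in> borel_measurable M"
  by (intro continuous_compose_borel continuous_intros)

lemma integrable_norm_diff_square: "integrable M (\<lambda>w. (norm (X w - \<theta>))\<^sup>2)"
  by (rule square_integrable.square[OF square_integrable_diff])

lemma integrable_rho: "integrable M (\<lambda>w. rho \<psi> (norm (X w - \<theta>)))"
proof (rule Bochner_Integration.integrable_bound[OF integrable_norm_diff_square[of \<theta>]])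
  have "rho \<psi> x \<le> x\<^sup>2" if "0 \<le> x" for x
    using rho_le_square[OF score that] zero_le_power2[of x] by linarith
  then show "AE w in M. norm (rho \<psi> (norm (X w - \<theta>))) \<le> norm ((norm (X w - \<theta>))\<^sup>2)"
    using rho_nonneg[OF score] by simp
qed (intro rho_borel[OF score] norm_diff_borel norm_ge_zero)

lemma square_integrable_score: "square_integrable M (\<lambda>w. score_vector \<psi> (X w - \<theta>))"
proof (rule square_integrable_dominated[of _ \<theta>])
  show "continuous_on UNIV (\<lambda>x. score_vector \<psi> (x - \<theta>))"
    by (rule continuous_on_compose2[OF score_vector_continuous[OF score]]) (auto intro!: continuous_intros)
  show "norm (score_vector \<psi> (x - \<theta>)) \<le> norm (x - \<theta>)" for x
    by (simp add: norm_score_vector[OF score] psi_le_id[OF score])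
qed

lemma has_bexp_mean_score: "has_bexp M (\<lambda>w. score_vector \<psi> (X w - \<theta>)) (mean_score \<theta>)"
  unfolding mean_score_def by (rule square_integrable.has_bexp_bexp[OF square_integrable_score])

lemma mean_score_inner:
  "integrable M (\<lambda>w. score_vector \<psi> (X w - \<theta>) \<bullet> h)"
  "(\<integral>w. score_vector \<psi> (X w - \<theta>) \<bullet> h \<partial>M) = mean_score \<theta> \<bullet> h"
  using square_integrable.has_bochner_integral_inner[OF square_integrable_score]
  unfolding mean_score_def by (auto simp: has_bochner_integral_iff)

lemma objective_above_gradient: "objective \<theta> - mean_score \<theta> \<bullet> h \<le> objective (\<theta> + h)"
proof -
  have "objective \<theta> - mean_score \<theta> \<bullet> h =
      (\<integral>w. rho \<psi> (norm (X w - \<theta>)) - score_vector \<psi> (X w - \<theta>) \<bullet> h \<partial>M)"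
    by (simp add: objective_def mean_score_inner integrable_rho)
  also have "\<dots> \<le> objective (\<theta> + h)"
    unfolding objective_def
  proof (rule integral_mono)
    fix w
    show "rho \<psi> (norm (X w - \<theta>)) - score_vector \<psi> (X w - \<theta>) \<bullet> h \<le> rho \<psi> (norm (X w - (\<theta> + h)))"
      using rho_norm_above_gradient[OF score, of "X w - \<theta>" "- h"] by (simp add: diff_diff_eq)
  qed (simp_all add: integrable_rho mean_score_inner)
  finally show ?thesis .
qed

lemma objective_below_gradient:
  "objective (\<theta> + h) \<le> objective \<theta> - mean_score \<theta> \<bullet> h + (norm h)\<^sup>2 / 2"
proof -
  have "objective (\<theta> + h) \<le>
      (\<integral>w. rho \<psi> (norm (X w - \<theta>)) - score_vector \<psi> (X w - \<theta>) \<bullet> h + (norm h)\<^sup>2 / 2 \<partial>M)"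
    unfolding objective_def
  proof (rule integral_mono)
    fix w
    show "rho \<psi> (norm (X w - (\<theta> + h))) \<le>
        rho \<psi> (norm (X w - \<theta>)) - score_vector \<psi> (X w - \<theta>) \<bullet> h + (norm h)\<^sup>2 / 2"
      using rho_norm_below_gradient[OF score, of "X w - \<theta>" "- h"] by (simp add: diff_diff_eq)
  qed (simp_all add: integrable_rho mean_score_inner)
  also have "\<dots> = objective \<theta> - mean_score \<theta> \<bullet> h + (norm h)\<^sup>2 / 2"
    by (simp add: objective_def mean_score_inner integrable_rho prob_space)
  finally show ?thesis .
qed

lemma mean_score_zero_iff_minimizer:
  "mean_score \<theta> = 0 \<longleftrightarrow> (\<forall>\<theta>'. objective \<theta> \<le> objective \<theta>')"
proof
  assume "mean_score \<theta> = 0"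
  then show "\<forall>\<theta>'. objective \<theta> \<le> objective \<theta>'"
    using objective_above_gradient[of \<theta> "\<theta>' - \<theta>" for \<theta>'] by simp
next
  assume "\<forall>\<theta>'. objective \<theta> \<le> objective \<theta>'"
  \<comment> \<open>The displacement \<open>h = mean_score \<theta>\<close> minimizes the quadratic
    upper bound and lowers it by half the squared norm of the mean score.\<close>
  then have "objective \<theta> \<le> objective (\<theta> + mean_score \<theta>)" by blast
  also have "\<dots> \<le> objective \<theta> - (norm (mean_score \<theta>))\<^sup>2 / 2"
    using objective_below_gradient[of \<theta> "mean_score \<theta>"] by (simp add: power2_norm_eq_inner)
  finally show "mean_score \<theta> = 0" by simp
qed

text \<open>The tangent of \<open>rho\<close> at \<open>\<beta>\<close> has slope
  \<open>\<psi> \<beta>\<close>; dropping the nonnegative \<open>rho \<psi> \<beta>\<close> and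
  using the triangle inequality gives an integrable affine minorant.\<close>

lemma objective_coercive:
  "\<psi> \<beta> * norm \<theta> - \<psi> \<beta> * ((\<integral>w. norm (X w) \<partial>M) + \<beta>) \<le> objective \<theta>"
proof -
  have "\<psi> \<beta> * norm \<theta> - \<psi> \<beta> * ((\<integral>w. norm (X w) \<partial>M) + \<beta>) =
      (\<integral>w. \<psi> \<beta> * (norm \<theta> - norm (X w) - \<beta>) \<partial>M)"
    using integrable_norm by (simp add: prob_space algebra_simps)
  also have "\<dots> \<le> objective \<theta>"
    unfolding objective_def
  proof (rule integral_mono)
    fix w
    have "\<psi> \<beta> * (norm \<theta> - norm (X w) - \<beta>) \<le> \<psi> \<beta> * (norm (X w - \<theta>) - \<beta>)"
      using norm_triangle_ineq2[of \<theta> "X w"] psi_nonneg[OF score, of \<beta>] beta_pos[OF score]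
      by (intro mult_left_mono) (auto simp: norm_minus_commute)
    also have "\<dots> \<le> rho \<psi> (norm (X w - \<theta>))"
      using rho_above_tangent[OF score, of \<beta> "norm (X w - \<theta>)"] rho_nonneg[OF score, of \<beta>]
        beta_pos[OF score] by simp
    finally show "\<psi> \<beta> * (norm \<theta> - norm (X w) - \<beta>) \<le> rho \<psi> (norm (X w - \<theta>))" .
  qed (use integrable_norm integrable_rho in auto)
  finally show ?thesis .
qed

lemma objective_minimizer_exists: "\<exists>\<theta>. \<forall>\<theta>'. objective \<theta> \<le> objective \<theta>'"
proof -
  have "\<exists>p\<in>UNIV. \<forall>x\<in>UNIV. objective p \<le> objective x"
  proof (rule midpoint_convex_attains_minimum)
    show "2 * objective ((1/2) *\<^sub>R (x + y)) \<le> objective x + objective y" for x y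
    proof -
      \<comment> \<open>The affine minorant at the midpoint \<open>m\<close> is used in the opposite
        directions \<open>x - m\<close> and \<open>y - m\<close>; the gradient terms cancel in the
        sum.\<close>
      define m where "m = (1/2) *\<^sub>R (x + y)"
      have "m + m = x + y"
        by (simp add: m_def flip: scaleR_add_left)
      then have "m + - (x - m) = y"
        by (simp add: algebra_simps)
      then have "2 * objective m \<le> objective x + objective y"
        using objective_above_gradient[of m "x - m"] objective_above_gradient[of m "- (x - m)"]
        by (simp add: inner_diff_right)
      then show ?thesis by (simp only: m_def)
    qed
    show "objective x \<le> l" if g: "g \<longlonglongrightarrow> x" and "\<And>n. objective (g n) \<le> c n" and c: "c \<longlonglongrightarrow> l" for g x c l
    proof (rule LIMSEQ_le)
      \<comment> \<open>Lower semicontinuity: the affine minorant at the limit \<open>x\<close> lies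
        below \<open>c n\<close> along \<open>g\<close> and tends to
        \<open>objective x\<close>.\<close>
      show "(\<lambda>n. objective x - mean_score x \<bullet> (g n - x)) \<longlonglongrightarrow> objective x"
        using tendsto_diff[OF tendsto_const tendsto_inner[OF tendsto_const tendsto_diff[OF g tendsto_const]],
            of "objective x" "mean_score x" x] by simp
      have "objective x - mean_score x \<bullet> (g n - x) \<le> c n" for n
        using objective_above_gradient[of x "g n - x"] that(2)[of n] by simp
      then show "\<exists>N. \<forall>n\<ge>N. objective x - mean_score x \<bullet> (g n - x) \<le> c n" by blast
    qed (rule c)
    show "0 < \<psi> \<beta>"
      using psi_pos[OF score] beta_pos[OF score] .
  qed (use objective_coercive in auto)
  then show ?thesis by simp
qed

text \<open>The score is strictly monotone on the event \<open>\<parallel>X - a\<parallel> < \<beta>\<close>, which has positive probability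
  because \<open>a\<close> is a minimizer.\<close>

lemma mean_score_zero_unique:
  assumes small: "objective \<theta>\<^sub>0 < rho \<psi> \<beta>" and a: "mean_score a = 0" and b: "mean_score b = 0"
  shows "a = b"
proof (rule ccontr)
  assume "a \<noteq> b"
  let ?D = "\<lambda>w. (score_vector \<psi> (X w - a) - score_vector \<psi> (X w - b)) \<bullet> ((X w - a) - (X w - b))"
  \<comment> \<open>The displacement \<open>(X w - a) - (X w - b)\<close> is the constant
    \<open>b - a\<close>, so the integral of this nonnegative function is a difference of two
    vanishing mean scores paired with it.\<close>
  have D: "?D w = score_vector \<psi> (X w - a) \<bullet> (b - a) - score_vector \<psi> (X w - b) \<bullet> (b - a)" for w
    by (simp add: inner_diff_left)
  have "integrable M ?D" "(\<integral>w. ?D w \<partial>M) = 0"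
    unfolding D using mean_score_inner a b by auto
  then have "AE w in M. ?D w = 0"
    using integral_nonneg_eq_0_iff_AE[of M ?D] score_vector_monotone[OF score] by blast
  then have "AE w in M. rho \<psi> \<beta> \<le> rho \<psi> (norm (X w - a))"
  proof eventually_elim
    fix w assume "?D w = 0"
    then have "\<beta> \<le> norm (X w - a)"
      using score_vector_strict_monotone[OF score, of "X w - a" "X w - b"] \<open>a \<noteq> b\<close> by force
    then show "rho \<psi> \<beta> \<le> rho \<psi> (norm (X w - a))"
      using rho_mono[OF score] beta_pos[OF score] by simp
  qed
  then have "(\<integral>w. rho \<psi> \<beta> \<partial>M) \<le> objective a"
    unfolding objective_def by (intro integral_mono_AE integrable_rho) auto
  also have "objective a \<le> objective \<theta>\<^sub>0"
    using a mean_score_zero_iff_minimizer by blast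
  finally show False using small by (simp add: prob_space)
qed

text \<open>Existence and uniqueness of the zero of the mean score make the definite description in
  \<open>location\<close> denote it.\<close>

lemma location_minimizes:
  assumes small: "objective \<theta>\<^sub>0 < rho \<psi> \<beta>"
  shows "objective (location \<psi> M X) \<le> objective \<theta>"
proof -
  have iff: "has_bexp M (\<lambda>w. score_vector \<psi> (X w - \<theta>)) 0 \<longleftrightarrow> mean_score \<theta> = 0" for \<theta>
    using has_bexp_mean_score[of \<theta>] has_bexp_unique by metis
  obtain t where t: "mean_score t = 0"
    using objective_minimizer_exists mean_score_zero_iff_minimizer by blast
  have "location \<psi> M X = t"
    unfolding location_eq iff using t mean_score_zero_unique[OF small] by (intro the_equality) auto
  then show ?thesis using t mean_score_zero_iff_minimizer by blast
qed

lemma V_psi_le: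
  assumes small: "objective \<theta> < rho \<psi> \<beta>"
  shows "V_psi \<psi> M X \<le> (\<integral>w. (norm (X w - \<theta>))\<^sup>2 \<partial>M)"
proof -
  let ?T = "location \<psi> M X"
  have "V_psi \<psi> M X \<le> (\<integral>w. 2 * rho \<psi> (norm (X w - ?T)) \<partial>M)"
    unfolding V_psi_def
  proof (rule integral_mono)
    show "integrable M (\<lambda>w. (\<psi> (norm (X w - ?T)))\<^sup>2)"
      using square_integrable.square[OF square_integrable_score[of ?T]]
      by (simp add: norm_score_vector[OF score])
  qed (simp_all add: integrable_rho psi_square_le_rho[OF score])
  also have "\<dots> = 2 * objective ?T"
    by (simp add: objective_def)
  also have "\<dots> \<le> 2 * objective \<theta>"
    using location_minimizes[OF small] by simp
  also have "\<dots> = (\<integral>w. 2 * rho \<psi> (norm (X w - \<theta>)) \<partial>M)"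
    by (simp add: objective_def)
  also have "\<dots> \<le> (\<integral>w. (norm (X w - \<theta>))\<^sup>2 \<partial>M)"
    using rho_le_square[OF score, of "norm (X w - \<theta>)" for w]
    by (intro integral_mono integrable_norm_diff_square integrable_mult_right integrable_rho)
      (simp add: mult.commute)
  finally show ?thesis .
qed

lemma v_psi_le:
  "v_psi \<psi> M X \<le> norm (covariance_operator M X) + (norm (bexp M X - location \<psi> M X))\<^sup>2"
    (is "_ \<le> ?c")
proof -
  let ?T = "location \<psi> M X"
  let ?Z = "\<lambda>w. score_vector \<psi> (X w - ?T)"
  \<comment> \<open>The scalar weight is absorbed into both factors, so the operator in
    \<open>v_psi\<close> is the second moment of the score vector; at \<open>z = 0\<close> both
    sides are 0.\<close>
  have "((\<psi> (norm z))\<^sup>2 / (norm z)\<^sup>2) *\<^sub>R outer z z = outer (score_vector \<psi> z) (score_vector \<psi> z)" for z :: 'a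
    by (rule blinfun_eqI) (simp add: score_vector_def power2_eq_square blinfun.scaleR_left)
  then have "v_psi \<psi> M X = norm (bexp M (\<lambda>w. outer (?Z w) (?Z w)))"
    by (simp add: v_psi_def Let_def)
  also have "\<dots> \<le> ?c"
  proof (rule square_integrable.norm_second_moment_le[OF square_integrable_score])
    fix u
    \<comment> \<open>The score vector is \<open>z\<close> times a factor in \<open>{0..1}\<close>,
      so its component along any \<open>u\<close> does not exceed that of \<open>z\<close> in
      absolute value.\<close>
    have le: "(score_vector \<psi> z \<bullet> u)\<^sup>2 \<le> (z \<bullet> u)\<^sup>2" for z :: 'a
    proof -
      have "\<bar>\<psi> (norm z) / norm z\<bar> \<le> 1"
        using psi_le_id[OF score, of "norm z"] psi_nonneg[OF score, of "norm z"]
        by (simp add: divide_le_eq_1)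
      then have "\<bar>\<psi> (norm z) / norm z\<bar> * \<bar>z \<bullet> u\<bar> \<le> 1 * \<bar>z \<bullet> u\<bar>"
        by (rule mult_right_mono) simp
      then show ?thesis
        by (simp add: score_vector_def abs_le_square_iff[symmetric] abs_mult)
    qed
    have "(\<integral>w. (?Z w \<bullet> u)\<^sup>2 \<partial>M) \<le> (\<integral>w. ((X w - ?T) \<bullet> u)\<^sup>2 \<partial>M)"
      by (intro integral_mono le square_integrable.integrable_inner_square
          square_integrable_score square_integrable_diff)
    also have "\<dots> = blinfun_apply (covariance_operator M X) u \<bullet> u + ((bexp M X - ?T) \<bullet> u)\<^sup>2"
      by (rule covariance_form)
    also have "\<dots> \<le> norm (covariance_operator M X) * (norm u)\<^sup>2 + (norm (bexp M X - ?T))\<^sup>2 * (norm u)\<^sup>2"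
    proof (rule add_mono)
      have "blinfun_apply (covariance_operator M X) u \<bullet> u \<le> norm (blinfun_apply (covariance_operator M X) u) * norm u"
        by (rule norm_cauchy_schwarz)
      also have "\<dots> \<le> (norm (covariance_operator M X) * norm u) * norm u"
        by (intro mult_right_mono norm_blinfun) simp
      finally show "blinfun_apply (covariance_operator M X) u \<bullet> u \<le> norm (covariance_operator M X) * (norm u)\<^sup>2"
        by (simp add: power2_eq_square mult.assoc)
      have "\<bar>(bexp M X - ?T) \<bullet> u\<bar>\<^sup>2 \<le> (norm (bexp M X - ?T) * norm u)\<^sup>2"
        by (intro power_mono Cauchy_Schwarz_ineq2) simp
      then show "((bexp M X - ?T) \<bullet> u)\<^sup>2 \<le> (norm (bexp M X - ?T))\<^sup>2 * (norm u)\<^sup>2"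
        by (simp add: power_mult_distrib)
    qed
    finally show "(\<integral>w. (?Z w \<bullet> u)\<^sup>2 \<partial>M) \<le> ?c * (norm u)\<^sup>2"
      by (simp add: algebra_simps)
  qed simp
  finally show ?thesis .
qed

end

theorem lemma6:
  fixes \<psi> :: "real \<Rightarrow> real" and \<beta> \<gamma> :: real
    and M :: "'w measure" and X :: "'w \<Rightarrow> 'a::{real_inner, banach}"
  assumes "score_function \<beta> \<gamma> \<psi>"
    and "prob_space M"
    and "strongly_measurable M X"
    and "integrable M (\<lambda>w. (norm (X w))\<^sup>2)"
    and "(\<integral>w. rho \<psi> (norm (X w - bexp M X)) \<partial>M) < min (rho \<psi> (\<beta> / 3)) ((\<psi> (\<beta> / 2))\<^sup>2 / 2)"
  shows "V_psi \<psi> M X \<le> (\<integral>w. (norm (X w - bexp M X))\<^sup>2 \<partial>M) \<and>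
    (\<integral>w. (norm (X w - bexp M X))\<^sup>2 \<partial>M) = op_trace (covariance_operator M X) \<and>
    v_psi \<psi> M X \<le>
      norm (covariance_operator M X) + (norm (bexp M X - location \<psi> M X))\<^sup>2"
proof -
  interpret score_estimation M X \<psi> \<beta> \<gamma>
    using assms by (intro score_estimation.intro square_integrable.intro
        square_integrable_axioms.intro score_estimation_axioms.intro)
  have "objective (bexp M X) < rho \<psi> (\<beta> / 3)"
    using assms(5) by (simp add: objective_def)
  \<comment> \<open>\<open>rho \<psi> \<beta>\<close> is the threshold in the uniqueness
    argument.\<close>
  also have "\<dots> \<le> rho \<psi> \<beta>"
    using beta_pos[OF score] by (intro rho_mono[OF score]) auto
  finally show ?thesis
    using V_psi_le op_trace_covariance v_psi_le by simp
qed

end
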